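(* Let $\mu_0=e^{-V}dx$ be a reference probability measure on $\mathbb{R}^d$, where $V$ is finite everywhere, convex, $C^2$ and satisfies $\operatorname{Hess}V>0$. Let $\mu$ be a probability measure on $\mathbb{R}^d$ and let $\mu_V$ be the pushforward of $\mu$ by $\nabla V$. Assume that there exists a Stein kernel $\tilde\tau_{V,\gamma}$ for $\mu_V$ with respect to the standard Gaussian measure $\gamma$. Then $$x\mapsto\tilde\tau_{V,\gamma}(\nabla V(x))\,(\operatorname{Hess}V(x))^{-1}$$ is a Stein kernel for $\mu$ relative to $\mu_0$. It is enough here that $\tilde\tau_{V,\gamma}$ be defined only in the sense of distributions (since $\nabla V$ is smooth and bijective, composing a distribution with it is possible).
   Context: For $f:\mathbb{R}^d\to\mathbb{R}^d$, $\nabla f$ denotes the Jacobian matrix, and $\langle A,B\rangle=\operatorname{Tr}(A^TB)$ is the Hilbert-Schmidt inner product of matrices. Stein kernel with respect to the standard Gaussian measure $\gamma$: a matrix-valued function $\tau$ on $\mathbb{R}^d$ is a Stein kernel for a probability measure $\nu$ on $\mathbb{R}^d$ with respect to $\gamma$ if $\int x\cdot f\,d\nu=\int\langle\tau,\nabla f\rangle\,d\nu$ for any smooth test function $f$ taking values in $\mathbb{R}^d$. Stein kernel relative to $\mu_0=e^{-V}dx$: a matrix-valued function $\tau$ on $\mathbb{R}^d$ is a Stein kernel for $\mu$ relative to $\mu_0$ if $\int\nabla V\cdot f\,d\mu=\int\langle\tau,\nabla f\rangle\,d\mu$ for any smooth test function $f$ taking values in $\mathbb{R}^d$. (The measure $\mu_0$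 itself is characterized by $\int\nabla V\cdot f\,d\mu_0=\int\operatorname{Tr}(\nabla f)\,d\mu_0$.)
   Formalization: In the remark on distributions, V is assumed C^{k+2} for kernels that are distributions of order at most k (V smooth for arbitrary ones), since for V only C^2 composing with ∇V and multiplying by (Hess V)^{-1} is undefined; the kernel distribution is read as τ times the measure. *)

theory Defs
  imports "HOL-Analysis.Analysis" "HOL-Probability.Probability"
begin

subsection \<open>Functions of class \<open>C\<^sup>k\<close> and test functions\<close>

text \<open>Iterated directional derivatives, the directions being given by a list of vectors.\<close>

fun dderivs :: "'a list \<Rightarrow> ('a::real_normed_vector \<Rightarrow> 'b::real_normed_vector) \<Rightarrow> 'a \<Rightarrow> 'b" where
  "dderivs [] f = f"
| "dderivs (v # vs) f = (\<lambda>x. frechet_derivative (dderivs vs f) (at x) v)"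

text \<open>Here \<open>k = \<infinity>\<close> is allowed and means smooth. Differentiability is required explicitly, since
  \<^const>\<open>frechet_derivative\<close> is arbitrary at points where the function is not differentiable.\<close>

definition class_C :: "enat \<Rightarrow> ('a::real_normed_vector \<Rightarrow> 'b::real_normed_vector) \<Rightarrow> bool" where
  "class_C k f \<longleftrightarrow>
     (\<forall>vs. enat (length vs) < k \<longrightarrow> (dderivs vs f) differentiable_on UNIV) \<and>
     (\<forall>vs. enat (length vs) \<le> k \<longrightarrow> continuous_on UNIV (dderivs vs f))"

definition test_space :: "enat \<Rightarrow> ('a::real_normed_vector \<Rightarrow> 'b::real_normed_vector) set" where
  "test_space k = {f. class_C k f \<and> compact (closure (support_on UNIV f))}"

subsection \<open>Gradient, Hessian, Hilbert-Schmidt inner product\<close>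

definition grad :: "('a::real_inner \<Rightarrow> real) \<Rightarrow> 'a \<Rightarrow> 'a" where
  "grad f x = (THE D. GDERIV f x :> D)"

definition hess :: "(real ^ 'n \<Rightarrow> real) \<Rightarrow> real ^ 'n \<Rightarrow> real ^ 'n ^ 'n" where
  "hess f x = jacobian (grad f) (at x)"

definition pos_def :: "real ^ 'n ^ 'n \<Rightarrow> bool" where
  "pos_def A \<longleftrightarrow> transpose A = A \<and> (\<forall>v. v \<noteq> 0 \<longrightarrow> v \<bullet> (A *v v) > 0)"

definition hs_inner :: "real ^ 'n ^ 'n \<Rightarrow> real ^ 'n ^ 'n \<Rightarrow> real" where
  "hs_inner A B = trace (transpose A ** B)"

subsection \<open>Stein kernels\<close>

text \<open>The test functions are the compactly supported smooth vector fields. Integrability of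
  \<open>\<langle>\<tau>, \<nabla>f\<rangle>\<close> has to be demanded, because the Bochner integral of a non-integrable function is \<open>0\<close>;
  the left-hand sides are integrals of bounded functions.\<close>

definition stein_kernel_gauss ::
  "(real ^ 'n) measure \<Rightarrow> (real ^ 'n \<Rightarrow> real ^ 'n ^ 'n) \<Rightarrow> bool" where
  "stein_kernel_gauss \<nu> \<tau> \<longleftrightarrow>
     (\<forall>f :: real ^ 'n \<Rightarrow> real ^ 'n. f \<in> test_space \<infinity> \<longrightarrow>
        integrable \<nu> (\<lambda>x. hs_inner (\<tau> x) (jacobian f (at x))) \<and>
        (\<integral>x. x \<bullet> f x \<partial>\<nu>) = (\<integral>x. hs_inner (\<tau> x) (jacobian f (at x)) \<partial>\<nu>))"

definition stein_kernel_rel ::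
  "(real ^ 'n \<Rightarrow> real) \<Rightarrow> (real ^ 'n) measure \<Rightarrow> (real ^ 'n \<Rightarrow> real ^ 'n ^ 'n) \<Rightarrow> bool" where
  "stein_kernel_rel V \<mu> \<tau> \<longleftrightarrow>
     (\<forall>f :: real ^ 'n \<Rightarrow> real ^ 'n. f \<in> test_space \<infinity> \<longrightarrow>
        integrable \<mu> (\<lambda>x. hs_inner (\<tau> x) (jacobian f (at x))) \<and>
        (\<integral>x. grad V x \<bullet> f x \<partial>\<mu>) = (\<integral>x. hs_inner (\<tau> x) (jacobian f (at x)) \<partial>\<mu>))"

subsection \<open>Stein kernels in the sense of distributions\<close>

text \<open>Convergence in the space of \<open>C\<^sup>k\<close> test functions: supports in a common compact set, and
  uniform convergence of all derivatives of order at most \<open>k\<close>.\<close>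

definition test_converges ::
  "enat \<Rightarrow> (nat \<Rightarrow> 'a::real_normed_vector \<Rightarrow> 'b::real_normed_vector) \<Rightarrow> ('a \<Rightarrow> 'b) \<Rightarrow> bool" where
  "test_converges k \<phi> \<psi> \<longleftrightarrow>
     (\<exists>K. compact K \<and> (\<forall>m. support_on UNIV (\<phi> m) \<subseteq> K)) \<and>
     (\<forall>vs. enat (length vs) \<le> k \<longrightarrow>
        uniform_limit UNIV (\<lambda>m. dderivs vs (\<phi> m)) (dderivs vs \<psi>) sequentially)"

text \<open>Matrix-valued distributions of order at most \<open>k\<close> (all distributions if \<open>k = \<infinity>\<close>), identified
  through the Hilbert-Schmidt pairing with functionals on matrix-valued test functions. The values
  outside \<^term>\<open>test_space k\<close> are irrelevant.\<close>

definition matrix_distribution :: "enat \<Rightarrow> ((real ^ 'n \<Rightarrow> real ^ 'n ^ 'n) \<Rightarrow> real) \<Rightarrow> bool" where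
  "matrix_distribution k T \<longleftrightarrow>
     (\<forall>\<Phi>\<in>test_space k. \<forall>\<Psi>\<in>test_space k. T (\<lambda>x. \<Phi> x + \<Psi> x) = T \<Phi> + T \<Psi>) \<and>
     (\<forall>c. \<forall>\<Phi>\<in>test_space k. T (\<lambda>x. c *\<^sub>R \<Phi> x) = c * T \<Phi>) \<and>
     (\<forall>\<phi> \<psi>. (\<forall>m. \<phi> m \<in> test_space k) \<and> \<psi> \<in> test_space k \<and> test_converges k \<phi> \<psi> \<longrightarrow>
        (\<lambda>m. T (\<phi> m)) \<longlonglongrightarrow> T \<psi>)"

text \<open>A distributional Stein kernel \<open>\<tau>\<close> for \<open>\<nu>\<close> is given by the functional
  \<open>T \<Phi> = \<integral> \<langle>\<tau>, \<Phi>\<rangle> d\<nu>\<close>, that is, by the distribution \<open>\<tau> \<nu>\<close>; for a function \<open>\<tau>\<close> this functional is:\<close>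

definition kernel_dist ::
  "(real ^ 'n) measure \<Rightarrow> (real ^ 'n \<Rightarrow> real ^ 'n ^ 'n) \<Rightarrow> (real ^ 'n \<Rightarrow> real ^ 'n ^ 'n) \<Rightarrow> real" where
  "kernel_dist \<nu> \<tau> \<Phi> = (\<integral>x. hs_inner (\<tau> x) (\<Phi> x) \<partial>\<nu>)"

definition stein_dist_gauss ::
  "enat \<Rightarrow> (real ^ 'n) measure \<Rightarrow> ((real ^ 'n \<Rightarrow> real ^ 'n ^ 'n) \<Rightarrow> real) \<Rightarrow> bool" where
  "stein_dist_gauss k \<nu> T \<longleftrightarrow> matrix_distribution k T \<and>
     (\<forall>f :: real ^ 'n \<Rightarrow> real ^ 'n. f \<in> test_space \<infinity> \<longrightarrow>
        (\<integral>x. x \<bullet> f x \<partial>\<nu>) = T (\<lambda>x. jacobian f (at x)))"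

definition stein_dist_rel ::
  "enat \<Rightarrow> (real ^ 'n \<Rightarrow> real) \<Rightarrow> (real ^ 'n) measure \<Rightarrow>
     ((real ^ 'n \<Rightarrow> real ^ 'n ^ 'n) \<Rightarrow> real) \<Rightarrow> bool" where
  "stein_dist_rel k V \<mu> T \<longleftrightarrow> matrix_distribution k T \<and>
     (\<forall>f :: real ^ 'n \<Rightarrow> real ^ 'n. f \<in> test_space \<infinity> \<longrightarrow>
        (\<integral>x. grad V x \<bullet> f x \<partial>\<mu>) = T (\<lambda>x. jacobian f (at x)))"

text \<open>If \<open>T\<close> represents \<open>\<tau>\<close> with respect to the pushforward of \<open>\<mu>\<close> by an injective map \<open>F\<close>, then
  \<open>dist_comp T F\<close> represents \<open>\<tau> \<circ> F\<close> with respect to \<open>\<mu>\<close>: since the reference measures correspond to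
  each other, no Jacobian determinant appears. The range of \<open>F\<close> may be a proper subset of the space,
  and then \<open>\<Phi> \<circ> F\<^sup>-\<^sup>1\<close> is extended by zero.\<close>

definition dist_comp ::
  "((real ^ 'n \<Rightarrow> real ^ 'n ^ 'n) \<Rightarrow> real) \<Rightarrow> (real ^ 'n \<Rightarrow> real ^ 'n) \<Rightarrow>
     (real ^ 'n \<Rightarrow> real ^ 'n ^ 'n) \<Rightarrow> real" where
  "dist_comp T F \<Phi> = T (\<lambda>y. if y \<in> range F then \<Phi> (inv F y) else 0)"

text \<open>The product \<open>\<tau> A\<close> of a distribution with a matrix-valued function, from
  \<open>\<langle>\<tau> A, \<Phi>\<rangle> = \<langle>\<tau>, \<Phi> A\<^sup>T\<rangle>\<close>.\<close>

definition dist_mult ::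
  "((real ^ 'n \<Rightarrow> real ^ 'n ^ 'n) \<Rightarrow> real) \<Rightarrow> (real ^ 'n \<Rightarrow> real ^ 'n ^ 'n) \<Rightarrow>
     (real ^ 'n \<Rightarrow> real ^ 'n ^ 'n) \<Rightarrow> real" where
  "dist_mult T A \<Phi> = T (\<lambda>x. \<Phi> x ** transpose (A x))"

lemma dist_mult_kernel_dist:
  fixes A :: "real ^ 'n \<Rightarrow> real ^ 'n ^ 'n"
  shows "dist_mult (kernel_dist \<nu> \<tau>) A = kernel_dist \<nu> (\<lambda>x. \<tau> x ** A x)"
proof -
  have "hs_inner B (C ** transpose D) = hs_inner (B ** D) C" for B C D :: "real ^ 'n ^ 'n"
    unfolding hs_inner_def matrix_transpose_mul
    by (metis matrix_mul_assoc trace_mul_sym)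
  then show ?thesis
    by (simp add: fun_eq_iff dist_mult_def kernel_dist_def)
qed

lemma dist_comp_kernel_dist:
  assumes "inj F" "F \<in> borel_measurable \<mu>"
    and "(\<lambda>y. hs_inner (\<tau> y) (if y \<in> range F then \<Phi> (inv F y) else 0)) \<in> borel_measurable borel"
  shows "dist_comp (kernel_dist (distr \<mu> borel F) \<tau>) F \<Phi> = kernel_dist \<mu> (\<lambda>x. \<tau> (F x)) \<Phi>"
  using assms by (simp add: dist_comp_def kernel_dist_def integral_distr)

end

theory Submission
  imports Defs
begin

text \<open>For a compactly supported smooth vector field \<open>f\<close>, the field \<open>g = f \<circ> (\<nabla>V)\<^sup>-\<^sup>1\<close>, extended by zero
  outside the open set \<open>\<nabla>V(\<real>\<^sup>d)\<close>, is compactly supported and its Jacobian at \<open>\<nabla>V(x)\<close> is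
  \<open>\<nabla>f(x) (Hess V(x))\<^sup>-\<^sup>1\<close>. Testing the Stein identity of \<open>\<mu>\<^sub>V\<close> with \<open>g\<close> therefore gives the
  claimed identity for \<open>f\<close>. Since \<open>g\<close> is only as smooth as \<open>\<nabla>V\<close>, the Stein identity has to be
  extended from smooth fields to fields of class \<open>C\<^sup>k\<^sup>+\<^sup>1\<close> first, by mollification and the continuity
  of a distribution of order \<open>k\<close>. A kernel that is a function is locally integrable, as one sees by
  testing with linear fields times a cutoff, and so it is a distribution of order 0.\<close>

subsection \<open>Functions of class \<open>C\<^sup>n\<close>\<close>

text \<open>Besides the regularity of \<open>g\<close>, the new functional must again be a
  distribution, so the map taking a matrix field \<Phi> to \<Phi> (Hess V)^-1, carried over by the
  inverse of grad V, has to be continuous on test functions. Regularity and continuity are two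
  readings of one statement about null sequences in C^n, proved by a single induction on the order.
  Extending by zero costs no smoothness because supports are compact in the domain: the image of
  such a support is closed, so its complement and the open range of grad V cover the space, and on
  each of the two sets the function is plainly regular. The orders fit exactly: V in C^(k+2) makes
  the inverse Hessian C^k, hence \<open>g\<close> is C^(k+1) and its Jacobian is a legitimate test
  function of order k. For V merely C^2 this leaves k = 0, which is why a function kernel must be
  shown to act on continuous fields.\<close>

primrec Ck :: "nat \<Rightarrow> ('a::euclidean_space \<Rightarrow> 'b::real_normed_vector) \<Rightarrow> bool" where
  "Ck 0 f \<longleftrightarrow> continuous_on UNIV f"
| "Ck (Suc n) f \<longleftrightarrow> f differentiable_on UNIV \<and>
     (\<forall>v. Ck n (\<lambda>x. frechet_derivative f (at x) v))"

text \<open>The head of the list is the derivative taken last, so appending exposes the derivative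
  taken first. This is the end at which \<open>Ck\<close> unfolds and at which product and chain
  rules apply.\<close>

lemma dderivs_append_single:
  "dderivs (vs @ [v]) f = dderivs vs (\<lambda>x. frechet_derivative f (at x) v)"
  by (induction vs) auto

lemma Ck_iff_dderivs:
  "Ck n f \<longleftrightarrow> (\<forall>vs. length vs < n \<longrightarrow> dderivs vs f differentiable_on UNIV) \<and>
     (\<forall>vs. length vs \<le> n \<longrightarrow> continuous_on UNIV (dderivs vs f))"
proof (induction n arbitrary: f)
  case 0
  then show ?case by simp
next
  case (Suc n)
  have split: "(\<forall>vs. P vs) \<longleftrightarrow> P [] \<and> (\<forall>v vs. P (vs @ [v]))" for P :: "'a list \<Rightarrow> bool"
    by (metis rev_exhaust)
  have "(\<forall>vs. length vs < Suc n \<longrightarrow> dderivs vs f differentiable_on UNIV) \<longleftrightarrow>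
        f differentiable_on UNIV \<and>
        (\<forall>v vs. length vs < n \<longrightarrow>
           dderivs vs (\<lambda>x. frechet_derivative f (at x) v) differentiable_on UNIV)"
    by (subst split) (simp add: dderivs_append_single del: dderivs.simps(2))
  moreover have "(\<forall>vs. length vs \<le> Suc n \<longrightarrow> continuous_on UNIV (dderivs vs f)) \<longleftrightarrow>
        continuous_on UNIV f \<and>
        (\<forall>v vs. length vs \<le> n \<longrightarrow>
           continuous_on UNIV (dderivs vs (\<lambda>x. frechet_derivative f (at x) v)))"
    by (subst split) (simp add: dderivs_append_single del: dderivs.simps(2))
  \<comment> \<open>\<open>Ck (Suc n)\<close> does not ask for continuity of \<open>f\<close>
    itself; the empty list on the other side gets it from differentiability.\<close>
  ultimately show ?case
    using differentiable_imp_continuous_on[of f UNIV] by (auto simp: Suc.IH)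
qed

lemma class_C_iff_Ck: "class_C k f \<longleftrightarrow> (\<forall>n. enat n \<le> k \<longrightarrow> Ck n f)"
proof
  assume L: "class_C k f"
  show "\<forall>n. enat n \<le> k \<longrightarrow> Ck n f"
  proof (intro allI impI)
    fix n assume n: "enat n \<le> k"
    have "enat m < k" if "m < n" for m
      using that n by (metis enat_ord_simps(2) order_less_le_trans)
    moreover have "enat m \<le> k" if "m \<le> n" for m
      using that n by (metis enat_ord_simps(1) order_trans)
    ultimately show "Ck n f"
      using L unfolding class_C_def Ck_iff_dderivs by blast
  qed
next
  assume R: "\<forall>n. enat n \<le> k \<longrightarrow> Ck n f"
  have "dderivs vs f differentiable_on UNIV" if "enat (length vs) < k" for vs
  proof -
    \<comment> \<open>Differentiability of a derivative of order m comes from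
      \<open>Ck (Suc m)\<close>. The strict bound m < k makes that order admissible, also for
      infinite k.\<close>
    have "enat (Suc (length vs)) \<le> k"
      using that by (metis Suc_ile_eq)
    with R show ?thesis
      unfolding Ck_iff_dderivs by blast
  qed
  moreover have "continuous_on UNIV (dderivs vs f)" if "enat (length vs) \<le> k" for vs
    using R that unfolding Ck_iff_dderivs by blast
  ultimately show "class_C k f"
    by (auto simp: class_C_def)
qed

text \<open>Derivatives are unique, so any explicit candidate \<open>f'\<close> may replace
  \<open>frechet_derivative\<close>. All later inductions exhibit such a formula.\<close>

lemma Ck_SucI:
  assumes "\<And>x. (f has_derivative f' x) (at x)" and "\<And>v. Ck n (\<lambda>x. f' x v)"
  shows "Ck (Suc n) f"
proof -
  have "frechet_derivative f (at x) = f' x" for x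
    using frechet_derivative_at[OF assms(1)] by simp
  then show ?thesis
    using assms by (auto simp: differentiable_on_def differentiable_def)
qed

lemma Ck_SucE:
  assumes "Ck (Suc n) f"
  obtains f' where "\<And>x. (f has_derivative f' x) (at x)" "\<And>v. Ck n (\<lambda>x. f' x v)"
  using assms that[of "\<lambda>x. frechet_derivative f (at x)"]
  by (auto simp: differentiable_on_def frechet_derivative_works)

lemma Ck_imp_continuous: "Ck n f \<Longrightarrow> continuous_on UNIV f"
  by (cases n) (auto intro: differentiable_imp_continuous_on)

lemma Ck_Suc_imp: "Ck (Suc n) f \<Longrightarrow> Ck n f"
  by (induction n arbitrary: f) (auto intro: differentiable_imp_continuous_on)

lemma Ck_mono: "Ck n f \<Longrightarrow> m \<le> n \<Longrightarrow> Ck m f"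
  by (induction n) (auto dest: Ck_Suc_imp simp: le_Suc_eq simp del: Ck.simps)

lemma Ck_const: "Ck n (\<lambda>x. c)"
  by (induction n arbitrary: c) (auto simp del: Ck.simps(2) intro: Ck_SucI[where f' = "\<lambda>x v. 0"])

lemma Ck_add: "Ck n f \<Longrightarrow> Ck n g \<Longrightarrow> Ck n (\<lambda>x. f x + g x)"
proof (induction n arbitrary: f g)
  case (Suc n)
  from Suc.prems obtain f' g' where
    "\<And>x. (f has_derivative f' x) (at x)" "\<And>v. Ck n (\<lambda>x. f' x v)"
    "\<And>x. (g has_derivative g' x) (at x)" "\<And>v. Ck n (\<lambda>x. g' x v)"
    by (metis Ck_SucE)
  then show ?case
    by (intro Ck_SucI[where f' = "\<lambda>x v. f' x v + g' x v"] Suc.IH has_derivative_add)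
qed (auto intro: continuous_intros)

text \<open>The Leibniz rule turns the derivative into two bilinear terms, in each of which one
  factor has used up one order. Scalar, inner and matrix products are all instances.\<close>

lemma Ck_bilinear:
  assumes "bounded_bilinear bil"
  shows "Ck n f \<Longrightarrow> Ck n g \<Longrightarrow> Ck n (\<lambda>x. bil (f x) (g x))"
proof (induction n arbitrary: f g)
  case 0
  then show ?case
    using bounded_bilinear.continuous_on[OF assms] by auto
next
  case (Suc n)
  from Suc.prems obtain f' g' where *:
    "\<And>x. (f has_derivative f' x) (at x)" "\<And>v. Ck n (\<lambda>x. f' x v)"
    "\<And>x. (g has_derivative g' x) (at x)" "\<And>v. Ck n (\<lambda>x. g' x v)"
    by (metis Ck_SucE)
  show ?case
    by (rule Ck_SucI[where f' = "\<lambda>x v. bil (f x) (g' x v) + bil (f' x v) (g x)"])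
      (use * Suc.prems in \<open>auto intro!: bounded_bilinear.FDERIV[OF assms] Ck_add Suc.IH
         dest: Ck_Suc_imp simp del: Ck.simps\<close>)
qed

lemma Ck_linear:
  assumes "bounded_linear L"
  shows "Ck n f \<Longrightarrow> Ck n (\<lambda>x. L (f x))"
proof (induction n arbitrary: f)
  case 0
  then show ?case
    using bounded_linear.continuous_on[OF assms] by auto
next
  case (Suc n)
  from Suc.prems obtain f' where
    "\<And>x. (f has_derivative f' x) (at x)" "\<And>v. Ck n (\<lambda>x. f' x v)"
    by (metis Ck_SucE)
  then show ?case
    by (intro Ck_SucI[where f' = "\<lambda>x v. L (f' x v)"] Suc.IH
        bounded_linear.has_derivative[OF assms])
qed

lemma Ck_scaleR: "Ck n f \<Longrightarrow> Ck n g \<Longrightarrow> Ck n (\<lambda>x. f x *\<^sub>R g x)"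
  by (rule Ck_bilinear[OF bounded_bilinear_scaleR])

lemma Ck_mult: "Ck n f \<Longrightarrow> Ck n g \<Longrightarrow> Ck n (\<lambda>x. f x * g x :: real)"
  by (rule Ck_bilinear[OF bounded_bilinear_mult])

lemma Ck_uminus: "Ck n f \<Longrightarrow> Ck n (\<lambda>x. - f x)"
  by (rule Ck_linear[OF bounded_linear_minus[OF bounded_linear_ident]])

lemma Ck_diff: "Ck n f \<Longrightarrow> Ck n g \<Longrightarrow> Ck n (\<lambda>x. f x - g x)"
  using Ck_add[OF _ Ck_uminus, of n f g] by simp

lemma Ck_sum: "(\<And>i. i \<in> I \<Longrightarrow> Ck n (f i)) \<Longrightarrow> Ck n (\<lambda>x. \<Sum>i\<in>I. f i x)"
  by (induction I rule: infinite_finite_induct) (auto intro: Ck_add Ck_const)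

lemma Ck_prod: "(\<And>i. i \<in> I \<Longrightarrow> Ck n (f i)) \<Longrightarrow> Ck n (\<lambda>x. \<Prod>i\<in>I. f i x :: real)"
  by (induction I rule: infinite_finite_induct) (auto intro: Ck_mult Ck_const)

lemma Ck_ident: "Ck n (\<lambda>x. x)"
  by (cases n) (auto simp del: Ck.simps(2) intro!: Ck_SucI[where f' = "\<lambda>x v. v"] Ck_const)

text \<open>The derivative of 1/f contains 1/f again, but only to order n, where the induction
  hypothesis already covers it.\<close>

lemma Ck_inverse:
  fixes f :: "'a::euclidean_space \<Rightarrow> real"
  assumes nz: "\<And>x. f x \<noteq> 0"
  shows "Ck n f \<Longrightarrow> Ck n (\<lambda>x. inverse (f x))"
proof (induction n)
  case 0
  then show ?case
    using nz by (auto intro: continuous_intros)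
next
  case (Suc n)
  from Suc.prems obtain f' where *:
    "\<And>x. (f has_derivative f' x) (at x)" "\<And>v. Ck n (\<lambda>x. f' x v)"
    by (metis Ck_SucE)
  show ?case
    by (rule Ck_SucI[where f' = "\<lambda>x v. - (inverse (f x) * f' x v * inverse (f x))"])
      (use * Suc nz in \<open>auto intro!: has_derivative_inverse Ck_uminus Ck_mult
         dest: Ck_Suc_imp simp del: Ck.simps\<close>)
qed

lemma Ck_componentwise:
  fixes f :: "'a::euclidean_space \<Rightarrow> real ^ 'n"
  shows "(\<And>i. Ck n (\<lambda>x. f x $ i)) \<Longrightarrow> Ck n f"
proof -
  assume "\<And>i. Ck n (\<lambda>x. f x $ i)"
  then have "Ck n (\<lambda>x. \<Sum>i\<in>UNIV. f x $ i *\<^sub>R axis i (1::real))"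
    by (intro Ck_sum Ck_scaleR Ck_const) auto
  also have "(\<lambda>x. \<Sum>i\<in>UNIV. f x $ i *\<^sub>R axis i (1::real)) = f"
    using basis_expansion[of "f _"] by (simp add: scalar_mult_eq_scaleR)
  finally show ?thesis .
qed

lemma Ck_det:
  assumes "\<And>i j. Ck n (\<lambda>x. A x $ i $ j)"
  shows "Ck n (\<lambda>x. det (A x :: real ^ 'n ^ 'n))"
  unfolding det_def by (intro Ck_sum Ck_mult Ck_prod Ck_const assms)

section \<open>Regularity of the inverse of a matrix function\<close>

lemma matrix_inv_inverse:
  fixes A :: "'a::field ^ 'n ^ 'n"
  assumes "invertible A"
  shows "A ** matrix_inv A = mat 1" and "matrix_inv A ** A = mat 1"
proof -
  have "A ** matrix_inv A = mat 1 \<and> matrix_inv A ** A = mat 1"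
    using assms unfolding invertible_def matrix_inv_def by (rule someI_ex)
  then show "A ** matrix_inv A = mat 1" and "matrix_inv A ** A = mat 1"
    by auto
qed

text \<open>By Cramer's rule the entries are quotients of determinants, which are polynomials in the
  entries of \<open>A\<close>; the inverse itself never has to be differentiated.\<close>

lemma Ck_matrix_inv_mult:
  fixes A :: "'a::euclidean_space \<Rightarrow> real ^ 'n ^ 'n"
  assumes A: "\<And>i j. Ck n (\<lambda>x. A x $ i $ j)" and inv: "\<And>x. invertible (A x)"
  shows "Ck n (\<lambda>x. matrix_inv (A x) *v b)"
proof -
  have nz: "det (A x) \<noteq> 0" for x
    using inv invertible_det_nz by blast
  have "matrix_inv (A x) *v b =
      (\<chi> k. det (\<chi> i j. if j = k then b $ i else A x $ i $ j) / det (A x))" for x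
  proof -
    have "A x *v (matrix_inv (A x) *v b) = b"
      using matrix_inv_inverse(1)[OF inv[of x]] by (simp add: matrix_vector_mul_assoc)
    then show ?thesis
      using cramer[OF nz] by blast
  qed
  moreover have "Ck n (\<lambda>x. (\<chi> k. det (\<chi> i j. if j = k then b $ i else A x $ i $ j) / det (A x)) :: real ^ 'n)"
  proof (rule Ck_componentwise)
    fix k
    have "Ck n (\<lambda>x. (\<chi> i j. if j = k then b $ i else A x $ i $ j) $ i $ j)" for i j
      using A by (cases "j = k") (simp_all add: Ck_const)
    then show "Ck n (\<lambda>x. (\<chi> k. det (\<chi> i j. if j = k then b $ i else A x $ i $ j) / det (A x)) $ k)"
      by (simp add: divide_inverse Ck_mult Ck_inverse Ck_det A nz)
  qed
  ultimately show ?thesis by simp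
qed

subsection \<open>Null sequences in \<open>C\<^sup>n\<close> and composition with an inverse map\<close>

text \<open>Regularity of the terms is bundled with uniform convergence to 0 of all derivatives up
  to order n, so one induction shows that an operation preserves C^n and that it is continuous
  there. Limit 0 is enough since the operations of interest are linear.\<close>

primrec null_Ck :: "nat \<Rightarrow> (nat \<Rightarrow> 'a::euclidean_space \<Rightarrow> 'b::real_normed_vector) \<Rightarrow> bool" where
  "null_Ck 0 \<theta> \<longleftrightarrow> (\<forall>m. continuous_on UNIV (\<theta> m)) \<and>
     uniform_limit UNIV \<theta> (\<lambda>x. 0) sequentially"
| "null_Ck (Suc n) \<theta> \<longleftrightarrow> (\<forall>m. \<theta> m differentiable_on UNIV) \<and>
     uniform_limit UNIV \<theta> (\<lambda>x. 0) sequentially \<and>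
     (\<forall>v. null_Ck n (\<lambda>m x. frechet_derivative (\<theta> m) (at x) v))"

lemma null_Ck_SucI:
  assumes "\<And>m x. (\<theta> m has_derivative \<theta>' m x) (at x)"
    and "uniform_limit UNIV \<theta> (\<lambda>x. 0) sequentially"
    and "\<And>v. null_Ck n (\<lambda>m x. \<theta>' m x v)"
  shows "null_Ck (Suc n) \<theta>"
proof -
  have "frechet_derivative (\<theta> m) (at x) = \<theta>' m x" for m x
    using frechet_derivative_at[OF assms(1)] by simp
  moreover have "\<theta> m differentiable_on UNIV" for m
    using assms(1) unfolding differentiable_on_def differentiable_def by blast
  ultimately show ?thesis
    using assms by simp
qed

lemma null_Ck_SucE:
  assumes "null_Ck (Suc n) \<theta>"
  obtains \<theta>' where "\<And>m x. (\<theta> m has_derivative \<theta>' m x) (at x)" "\<And>v. null_Ck n (\<lambda>m x. \<theta>' m x v)"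
  using assms that[of "\<lambda>m x. frechet_derivative (\<theta> m) (at x)"]
  by (auto simp: differentiable_on_def frechet_derivative_works)

lemma null_Ck_imp_uniform: "null_Ck n \<theta> \<Longrightarrow> uniform_limit UNIV \<theta> (\<lambda>x. 0) sequentially"
  by (cases n) auto

lemma null_Ck_imp_Ck: "null_Ck n \<theta> \<Longrightarrow> Ck n (\<theta> m)"
  by (induction n arbitrary: \<theta>) auto

lemma null_Ck_Suc_imp: "null_Ck (Suc n) \<theta> \<Longrightarrow> null_Ck n \<theta>"
  by (induction n arbitrary: \<theta>) (auto intro: differentiable_imp_continuous_on)

text \<open>\<open>frechet_derivative\<close> is additive only where both summands are
  differentiable, so the order of regularity has to be tracked. The lemma passes between convergence
  to \<psi> and nullity of the difference.\<close>

lemma Ck_dderivs_add: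
  "Ck n f \<Longrightarrow> Ck n g \<Longrightarrow> length vs \<le> n \<Longrightarrow>
   dderivs vs (\<lambda>x. f x + g x) = (\<lambda>x. dderivs vs f x + dderivs vs g x)"
proof (induction n arbitrary: f g vs)
  case 0
  then show ?case by simp
next
  case (Suc n)
  show ?case
  proof (cases vs rule: rev_cases)
    case (snoc ws v)
    have "frechet_derivative (\<lambda>x. f x + g x) (at x) v =
        frechet_derivative f (at x) v + frechet_derivative g (at x) v" for x
      using Suc.prems(1,2)
      by (intro has_derivative_add fun_cong[OF frechet_derivative_at[symmetric], of _
            "\<lambda>v. frechet_derivative f (at x) v + frechet_derivative g (at x) v"])
        (auto simp: differentiable_on_def frechet_derivative_works)
    moreover have "length ws \<le> n"
      using Suc.prems(3) snoc by simp
    ultimately show ?thesis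
      unfolding snoc dderivs_append_single using Suc.prems(1,2)
      by (simp add: Suc.IH)
  qed simp
qed

lemma null_Ck_iff_dderivs:
  "null_Ck n \<theta> \<longleftrightarrow> (\<forall>m. Ck n (\<theta> m)) \<and>
     (\<forall>vs. length vs \<le> n \<longrightarrow> uniform_limit UNIV (\<lambda>m. dderivs vs (\<theta> m)) (\<lambda>x. 0) sequentially)"
proof (induction n arbitrary: \<theta>)
  case 0
  then show ?case by auto
next
  case (Suc n)
  have split: "(\<forall>vs. P vs) \<longleftrightarrow> P [] \<and> (\<forall>v vs. P (vs @ [v]))" for P :: "'a list \<Rightarrow> bool"
    by (metis rev_exhaust)
  show ?case
    by (subst split) (auto simp: Suc.IH dderivs_append_single simp del: dderivs.simps(2))
qed

lemma null_Ck_add: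
  "null_Ck n \<theta> \<Longrightarrow> null_Ck n \<eta> \<Longrightarrow> null_Ck n (\<lambda>m x. \<theta> m x + \<eta> m x)"
proof (induction n arbitrary: \<theta> \<eta>)
  case 0
  then show ?case
    using uniform_limit_add[OF null_Ck_imp_uniform null_Ck_imp_uniform, OF "0.prems"]
    by (auto intro: continuous_intros)
next
  case (Suc n)
  from Suc.prems obtain \<theta>' \<eta>' where
    "\<And>m x. (\<theta> m has_derivative \<theta>' m x) (at x)" "\<And>v. null_Ck n (\<lambda>m x. \<theta>' m x v)"
    "\<And>m x. (\<eta> m has_derivative \<eta>' m x) (at x)" "\<And>v. null_Ck n (\<lambda>m x. \<eta>' m x v)"
    by (metis null_Ck_SucE)
  moreover have "uniform_limit UNIV (\<lambda>m x. \<theta> m x + \<eta> m x) (\<lambda>x. 0) sequentially"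
    using uniform_limit_add[OF null_Ck_imp_uniform null_Ck_imp_uniform, OF Suc.prems] by simp
  ultimately show ?case
    by (intro null_Ck_SucI[where \<theta>' = "\<lambda>m x v. \<theta>' m x v + \<eta>' m x v"] Suc.IH has_derivative_add)
qed

lemma null_Ck_zero: "null_Ck n (\<lambda>m x. 0)"
  by (induction n) (auto intro: null_Ck_SucI[where \<theta>' = "\<lambda>m x v. 0"] simp: uniform_limit_const
      simp del: null_Ck.simps(2))

lemma null_Ck_sum:
  "(\<And>i. i \<in> I \<Longrightarrow> null_Ck n (\<theta> i)) \<Longrightarrow> null_Ck n (\<lambda>m x. \<Sum>i\<in>I. \<theta> i m x)"
  by (induction I rule: infinite_finite_induct) (auto intro: null_Ck_add null_Ck_zero)

lemma uniform_limit_zero_bounded_mult: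
  fixes \<theta> :: "nat \<Rightarrow> 'a \<Rightarrow> 'b::real_normed_vector" and \<eta> :: "nat \<Rightarrow> 'a \<Rightarrow> 'c::real_normed_vector"
  assumes "uniform_limit S \<theta> (\<lambda>x. 0) F" and "\<And>m x. x \<in> S \<Longrightarrow> norm (\<eta> m x) \<le> C * norm (\<theta> m x)"
  shows "uniform_limit S \<eta> (\<lambda>x. 0) F"
proof (rule uniform_limitI)
  fix e :: real assume "e > 0"
  \<comment> \<open>Nothing is known about the sign of \<open>C\<close>; the absolute value plus 1
    gives a positive denominator.\<close>
  then have "e / (\<bar>C\<bar> + 1) > 0" by simp
  then have "\<forall>\<^sub>F m in F. \<forall>x\<in>S. dist (\<theta> m x) 0 < e / (\<bar>C\<bar> + 1)"
    by (rule uniform_limitD[OF assms(1)])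
  then show "\<forall>\<^sub>F m in F. \<forall>x\<in>S. dist (\<eta> m x) 0 < e"
  proof (eventually_elim, safe)
    fix m x assume *: "\<forall>x\<in>S. dist (\<theta> m x) 0 < e / (\<bar>C\<bar> + 1)" and "x \<in> S"
    then have "norm (\<theta> m x) * (\<bar>C\<bar> + 1) < e"
      by (simp add: pos_less_divide_eq)
    moreover have "C * norm (\<theta> m x) \<le> norm (\<theta> m x) * (\<bar>C\<bar> + 1)"
      using mult_right_mono[of C "\<bar>C\<bar> + 1" "norm (\<theta> m x)"] by (simp add: mult.commute)
    ultimately show "dist (\<eta> m x) 0 < e"
      using assms(2)[OF \<open>x \<in> S\<close>, of m] by simp
  qed
qed

text \<open>The complement of \<open>K\<close> is open, so \<open>f\<close> agrees with the zero
  function near \<open>x\<close>. Hence supports do not grow under differentiation.\<close>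

lemma has_derivative_zero_outside:
  assumes "(f has_derivative f') (at x)" "closed K" "\<And>y. y \<notin> K \<Longrightarrow> f y = 0" "x \<notin> K"
  shows "f' v = 0"
proof -
  have "((\<lambda>y. 0) has_derivative f') (at x)"
    by (rule has_derivative_transform_within_open[OF assms(1), of "- K"])
      (use assms in auto)
  then have "f' = (\<lambda>v. 0)"
    using has_derivative_unique[OF _ has_derivative_const] by blast
  then show ?thesis by simp
qed

text \<open>The fixed factor \<open>f\<close> may be unbounded on the whole space. The common
  compact support of the sequence confines it to \<open>K\<close>, where it is bounded, and the
  derivatives keep that support.\<close>

lemma null_Ck_bilinear:
  assumes bil: "bounded_bilinear bil" and K: "compact K"
  shows "Ck n f \<Longrightarrow> null_Ck n \<theta> \<Longrightarrow> (\<And>m x. x \<notin> K \<Longrightarrow> \<theta> m x = 0) \<Longrightarrow>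
    null_Ck n (\<lambda>m x. bil (f x) (\<theta> m x))"
proof (induction n arbitrary: f \<theta>)
  have ul: "uniform_limit UNIV (\<lambda>m x. bil (f x) (\<theta> m x)) (\<lambda>x. 0) sequentially"
    if f: "continuous_on UNIV f" and \<theta>: "uniform_limit UNIV \<theta> (\<lambda>x. 0) sequentially"
      and supp: "\<And>m x. x \<notin> K \<Longrightarrow> \<theta> m x = 0" for f \<theta>
  proof -
    have "bounded (f ` K)"
      using K f by (meson compact_continuous_image compact_imp_bounded continuous_on_subset subset_UNIV)
    then obtain B where B: "\<And>x. x \<in> K \<Longrightarrow> norm (f x) \<le> B"
      by (auto simp: bounded_iff)
    obtain C where C: "C > 0" "\<And>a b. norm (bil a b) \<le> norm a * norm b * C"
      using bounded_bilinear.pos_bounded[OF bil] by blast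
    have "norm (bil (f x) (\<theta> m x)) \<le> (C * B) * norm (\<theta> m x)" for m x
    proof (cases "x \<in> K")
      case True
      have "norm (f x) * norm (\<theta> m x) * C \<le> B * norm (\<theta> m x) * C"
        using B[OF True] C(1) by (intro mult_right_mono) auto
      then show ?thesis
        using C(2)[of "f x" "\<theta> m x"] by (simp add: algebra_simps)
    next
      case False
      then show ?thesis
        by (simp add: supp bounded_bilinear.zero_right[OF bil])
    qed
    then show ?thesis
      by (rule uniform_limit_zero_bounded_mult[OF \<theta>])
  qed
  {
    case 0
    then show ?case
      using ul[of f \<theta>] by (auto intro: bounded_bilinear.continuous_on[OF bil])
  next
    case (Suc n)
    obtain f' where f': "\<And>x. (f has_derivative f' x) (at x)" "\<And>v. Ck n (\<lambda>x. f' x v)"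
      using Suc.prems(1) by (metis Ck_SucE)
    obtain \<theta>' where \<theta>': "\<And>m x. (\<theta> m has_derivative \<theta>' m x) (at x)"
        "\<And>v. null_Ck n (\<lambda>m x. \<theta>' m x v)"
      using Suc.prems(2) by (metis null_Ck_SucE)
    have supp': "\<theta>' m x v = 0" if "x \<notin> K" for m x v
      using has_derivative_zero_outside[OF \<theta>'(1) compact_imp_closed[OF K] Suc.prems(3) that] .
    have 1: "null_Ck n (\<lambda>m x. bil (f x) (\<theta>' m x v))" for v
      using Suc.IH[OF Ck_Suc_imp[OF Suc.prems(1)] \<theta>'(2)] supp' by blast
    have 2: "null_Ck n (\<lambda>m x. bil (f' x v) (\<theta> m x))" for v
      using Suc.IH[OF f'(2) null_Ck_Suc_imp[OF Suc.prems(2)]] Suc.prems(3) by blast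
    show ?case
    proof (rule null_Ck_SucI[where \<theta>' = "\<lambda>m x v. bil (f x) (\<theta>' m x v) + bil (f' x v) (\<theta> m x)"])
      show "((\<lambda>x. bil (f x) (\<theta> m x)) has_derivative
          (\<lambda>v. bil (f x) (\<theta>' m x v) + bil (f' x v) (\<theta> m x))) (at x)" for m x
        by (rule bounded_bilinear.FDERIV[OF bil f'(1) \<theta>'(1)])
      show "uniform_limit UNIV (\<lambda>m x. bil (f x) (\<theta> m x)) (\<lambda>x. 0) sequentially"
        using ul[of f \<theta>] Ck_imp_continuous[OF Suc.prems(1)] null_Ck_imp_uniform[OF Suc.prems(2)]
          Suc.prems(3) by blast
      show "null_Ck n (\<lambda>m x. bil (f x) (\<theta>' m x v) + bil (f' x v) (\<theta> m x))" for v
        by (rule null_Ck_add[OF 1 2])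
    qed
  }
qed

lemma null_Ck_linear:
  assumes "bounded_linear L"
  shows "null_Ck n \<theta> \<Longrightarrow> null_Ck n (\<lambda>m x. L (\<theta> m x))"
proof (induction n arbitrary: \<theta>)
  obtain C where C: "\<And>a. norm (L a) \<le> C * norm a"
    using bounded_linear.bounded[OF assms] by (auto simp: mult.commute)
  {
    case 0
    then show ?case
      using uniform_limit_zero_bounded_mult[OF null_Ck_imp_uniform[OF "0.prems"] C]
      by (auto intro: bounded_linear.continuous_on[OF assms])
  next
    case (Suc n)
    from Suc.prems obtain \<theta>' where
      "\<And>m x. (\<theta> m has_derivative \<theta>' m x) (at x)" "\<And>v. null_Ck n (\<lambda>m x. \<theta>' m x v)"
      by (metis null_Ck_SucE)
    then show ?case
      using uniform_limit_zero_bounded_mult[OF null_Ck_imp_uniform[OF Suc.prems] C]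
      by (intro null_Ck_SucI[where \<theta>' = "\<lambda>m x v. L (\<theta>' m x v)"] Suc.IH
          bounded_linear.has_derivative[OF assms]) auto
  }
qed

text \<open>Reduces regularity of a single compactly supported function to statements about null
  sequences.\<close>

lemma null_Ck_shrink:
  assumes K: "compact K"
  shows "Ck n f \<Longrightarrow> (\<And>x. x \<notin> K \<Longrightarrow> f x = 0) \<Longrightarrow> null_Ck n (\<lambda>m x. f x /\<^sub>R real (Suc m))"
proof (induction n arbitrary: f)
  have ul: "uniform_limit UNIV (\<lambda>m x. f x /\<^sub>R real (Suc m)) (\<lambda>x. 0) sequentially"
    if f: "continuous_on UNIV f" and supp: "\<And>x. x \<notin> K \<Longrightarrow> f x = 0" for f :: "'a \<Rightarrow> 'b"
  proof -
    have "bounded (f ` K)"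
      using K f by (meson compact_continuous_image compact_imp_bounded continuous_on_subset subset_UNIV)
    then obtain B where B: "B > 0" "\<And>x. x \<in> K \<Longrightarrow> norm (f x) \<le> B"
      by (auto simp: bounded_pos)
    have fB: "norm (f x) \<le> B" for x
      using B supp by (cases "x \<in> K") auto
    have "uniform_limit UNIV (\<lambda>m x::'a. inverse (real (Suc m))) (\<lambda>x. 0) sequentially"
      using LIMSEQ_inverse_real_of_nat by (intro uniform_limitI) (auto dest: tendstoD)
    then show ?thesis
      by (rule uniform_limit_zero_bounded_mult[where C = B])
        (use fB in \<open>auto simp: divide_simps mult_right_mono\<close>)
  qed
  {
    case 0
    then show ?case
      using ul by (auto intro!: continuous_intros)
  next
    case (Suc n)
    from Suc.prems(1) obtain f' where *:
      "\<And>x. (f has_derivative f' x) (at x)" "\<And>v. Ck n (\<lambda>x. f' x v)"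
      by (metis Ck_SucE)
    have supp': "f' x v = 0" if "x \<notin> K" for x v
      using has_derivative_zero_outside[OF *(1) compact_imp_closed[OF K] Suc.prems(2) that] .
    show ?case
      by (rule null_Ck_SucI[where \<theta>' = "\<lambda>m x v. f' x v /\<^sub>R real (Suc m)"])
        (use * supp' ul[OF Ck_imp_continuous[OF Suc.prems(1)] Suc.prems(2)] in
          \<open>auto intro!: Suc.IH has_derivative_scaleR_right simp del: null_Ck.simps of_nat_Suc\<close>)
  }
qed

section \<open>Composition with the inverse of a nonsingular injection\<close>

text \<open>The argument that \<open>dist_comp\<close> feeds to a distribution, made polymorphic
  because it is applied to vector fields, to matrix fields and to their directional
  derivatives.\<close>

definition push_zero :: "('a \<Rightarrow> 'c) \<Rightarrow> ('a \<Rightarrow> 'b::zero) \<Rightarrow> 'c \<Rightarrow> 'b" where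
  "push_zero F \<theta> y = (if y \<in> range F then \<theta> (inv F y) else 0)"

lemma push_zero_apply: "inj F \<Longrightarrow> push_zero F \<theta> (F x) = \<theta> x"
  by (simp add: push_zero_def)

lemma push_zero_outside:
  assumes "\<And>x. x \<notin> K \<Longrightarrow> \<theta> x = 0" and "y \<notin> F ` K"
  shows "push_zero F \<theta> y = 0"
  using assms by (auto simp: push_zero_def) (metis f_inv_into_f imageI rangeI)

text \<open>The derivative has a right inverse at every point, which in equal finite dimensions is
  two-sided. It is the derivative of the inverse map, but indexed by the point of the domain, so
  that it is defined on the whole space.\<close>

locale nonsingular_injection =
  fixes F :: "'a::euclidean_space \<Rightarrow> 'a" and F' F'inv :: "'a \<Rightarrow> 'a \<Rightarrow> 'a"
  assumes inj: "inj F"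
    and F': "\<And>x. (F has_derivative F' x) (at x)"
    and F'inv: "\<And>x. bounded_linear (F'inv x)" "\<And>x v. F' x (F'inv x v) = v"
begin

lemma cont: "continuous_on S F"
  using F' by (meson continuous_at_imp_continuous_on has_derivative_continuous)

lemma open_range: "open (range F)"
  using invariance_of_domain[OF cont open_UNIV inj] .

lemma has_derivative_inv: "(inv F has_derivative F'inv x) (at (F x))"
  by (rule has_derivative_inverse_on[OF open_UNIV, where f' = F'])
    (use F' F'inv inj in auto)

lemma compact_image: "compact K \<Longrightarrow> compact (F ` K)"
  by (rule compact_continuous_image[OF cont])

lemma push_zero_has_derivative:
  assumes K: "compact K" and supp: "\<And>x. x \<notin> K \<Longrightarrow> \<theta> x = 0"
    and \<theta>: "\<And>x. (\<theta> has_derivative \<theta>' x) (at x)"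
  shows "(push_zero F \<theta> has_derivative (\<lambda>v. push_zero F (\<lambda>x. \<theta>' x (F'inv x v)) y)) (at y)"
proof (cases "y \<in> range F")
  case True
  then obtain x where y: "y = F x" by auto
  have "(\<theta> \<circ> inv F has_derivative \<theta>' x \<circ> F'inv x) (at y)"
    using diff_chain_at[OF has_derivative_inv[of x], of \<theta>] \<theta>[of x] inj by (simp add: y)
  then have "(push_zero F \<theta> has_derivative \<theta>' x \<circ> F'inv x) (at y)"
    by (rule has_derivative_transform_within_open[OF _ open_range True]) (simp add: push_zero_def)
  then show ?thesis
    by (simp add: y push_zero_apply[OF inj] o_def)
next
  case False
  have zero: "push_zero F \<theta> z = 0" if "z \<in> - F ` K" for z
    by (rule push_zero_outside[where K = K]) (use supp that in auto)
  have "(push_zero F \<theta> has_derivative (\<lambda>v. 0)) (at y)"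
    by (rule has_derivative_transform_within_open[OF has_derivative_const[of 0], of "- F ` K"])
      (use False zero compact_imp_closed[OF compact_image[OF K]] in auto)
  then show ?thesis
    using False by (simp add: push_zero_def)
qed

lemma push_zero_continuous:
  assumes K: "compact K" and supp: "\<And>x. x \<notin> K \<Longrightarrow> \<theta> x = 0" and \<theta>: "continuous_on UNIV \<theta>"
  shows "continuous_on UNIV (push_zero F \<theta>)"
proof -
  have "continuous_on (range F) (inv F)"
    by (intro continuous_at_imp_continuous_on ballI)
      (auto intro: has_derivative_continuous[OF has_derivative_inv])
  then have "continuous_on (range F) (\<lambda>y. \<theta> (inv F y))"
    by (intro continuous_on_compose2[OF \<theta>]) auto
  then have 1: "continuous_on (range F) (push_zero F \<theta>)"
    by (simp add: push_zero_def cong: continuous_on_cong)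
  have "continuous_on (- F ` K) (\<lambda>y. 0 :: 'b)"
    by simp
  then have 2: "continuous_on (- F ` K) (push_zero F \<theta>)"
    by (rule continuous_on_eq) (simp add: push_zero_outside[where K = K] supp)
  have "range F \<union> - F ` K = UNIV" by auto
  then show ?thesis
    using continuous_on_open_Un[OF open_range _ 1 2] compact_imp_closed[OF compact_image[OF K]]
    by auto
qed

text \<open>The derivative of \<open>\<theta> \<circ> F\<^sup>-\<^sup>1\<close> in direction \<open>v\<close> is again of the form \<open>\<eta> \<circ> F\<^sup>-\<^sup>1\<close> with \<open>\<eta>\<close>
  defined on the whole space, so that no smoothness of \<open>F\<^sup>-\<^sup>1\<close> beyond its first derivative has to be
  discussed.\<close>

lemma null_Ck_push_zero:
  assumes K: "compact K"
  shows "null_Ck n \<theta> \<Longrightarrow> (\<And>m x. x \<notin> K \<Longrightarrow> \<theta> m x = 0) \<Longrightarrow>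
    (\<And>v. Ck (n - 1) (\<lambda>x. F'inv x v)) \<Longrightarrow> null_Ck n (\<lambda>m. push_zero F (\<theta> m))"
proof (induction n arbitrary: \<theta>)
  have ul: "uniform_limit UNIV (\<lambda>m. push_zero F (\<theta> m)) (\<lambda>x. 0) sequentially"
    if "uniform_limit UNIV \<theta> (\<lambda>x. 0) sequentially" for \<theta> :: "nat \<Rightarrow> 'a \<Rightarrow> 'b"
  proof (rule uniform_limitI)
    fix e :: real assume "e > 0"
    from uniform_limitD[OF that this]
    show "\<forall>\<^sub>F m in sequentially. \<forall>y\<in>UNIV. dist (push_zero F (\<theta> m) y) 0 < e"
      by (rule eventually_mono) (use \<open>e > 0\<close> in \<open>simp add: push_zero_def\<close>)
  qed
  {
    case 0
    then show ?case
      using ul push_zero_continuous[OF K "0.prems"(2)] by auto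
  next
    case (Suc n)
    from Suc.prems(1) obtain \<theta>' where *:
      "\<And>m x. (\<theta> m has_derivative \<theta>' m x) (at x)" "\<And>v. null_Ck n (\<lambda>m x. \<theta>' m x v)"
      by (metis null_Ck_SucE)
    have supp': "\<theta>' m x v = 0" if "x \<notin> K" for m x v
      using has_derivative_zero_outside[OF *(1) compact_imp_closed[OF K] Suc.prems(2) that] .
    \<comment> \<open>At order \<open>Suc n\<close> the hypothesis reads
      \<open>Suc n - 1 = n\<close>. The induction hypothesis asks for \<open>n - 1\<close>,
      truncated to plain continuity when \<open>n = 0\<close>.\<close>
    have F'inv_Ck: "Ck n (\<lambda>x. F'inv x v)" for v
      using Suc.prems(3) by simp
    show ?case
    proof (rule null_Ck_SucI[OF push_zero_has_derivative[OF K Suc.prems(2) *(1)]])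
      show "uniform_limit UNIV (\<lambda>m. push_zero F (\<theta> m)) (\<lambda>x. 0) sequentially"
        by (rule ul[OF null_Ck_imp_uniform[OF Suc.prems(1)]])
      fix v
      \<comment> \<open>Nullity of the derivatives is known in fixed directions, whereas
        \<open>F'inv x v\<close> moves with \<open>x\<close>. Expanding in the basis moves this
        dependence into scalar coefficients of class C^n.\<close>
      have expand: "\<theta>' m x w = (\<Sum>b\<in>Basis. (w \<bullet> b) *\<^sub>R \<theta>' m x b)" for m x w
      proof -
        interpret bounded_linear "\<theta>' m x"
          using *(1) by (rule has_derivative_bounded_linear)
        have "\<theta>' m x w = \<theta>' m x (\<Sum>b\<in>Basis. (w \<bullet> b) *\<^sub>R b)"
          by (simp add: euclidean_representation)
        then show ?thesis
          by (simp add: sum scaleR)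
      qed
      have "null_Ck n (\<lambda>m x. \<Sum>b\<in>Basis. (F'inv x v \<bullet> b) *\<^sub>R \<theta>' m x b)"
        by (intro null_Ck_sum null_Ck_bilinear[OF bounded_bilinear_scaleR K]
            Ck_linear[OF bounded_linear_inner_left] F'inv_Ck *(2)) (simp add: supp')
      then have "null_Ck n (\<lambda>m x. \<theta>' m x (F'inv x v))"
        by (simp only: expand[symmetric])
      then show "null_Ck n (\<lambda>m. push_zero F (\<lambda>x. \<theta>' m x (F'inv x v)))"
      proof (rule Suc.IH)
        show "Ck (n - 1) (\<lambda>x. F'inv x v)" for v
          using F'inv_Ck Ck_mono diff_le_self by blast
      qed (simp add: supp')
    qed
  }
qed

text \<open>The sequence f/(m+1) is null, hence so is its image, and every member of a null sequence
  is C^n. The member m = 0 is \<open>push_zero F f\<close>.\<close>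

lemma Ck_push_zero:
  assumes K: "compact K" and f: "Ck n f" "\<And>x. x \<notin> K \<Longrightarrow> f x = 0"
    and F'inv: "\<And>v. Ck (n - 1) (\<lambda>x. F'inv x v)"
  shows "Ck n (push_zero F f)"
proof -
  have "null_Ck n (\<lambda>m. push_zero F (\<lambda>x. f x /\<^sub>R real (Suc m)))"
    by (rule null_Ck_push_zero[OF K null_Ck_shrink[OF K f]]) (use f F'inv in auto)
  then have "Ck n (push_zero F (\<lambda>x. f x /\<^sub>R real (Suc 0)))"
    by (rule null_Ck_imp_Ck)
  then show ?thesis by simp
qed

end

subsection \<open>Smooth bumps and mollification\<close>

text \<open>The derivative of a member of this family is a linear combination of members, which makes the
  induction for smoothness go through.\<close>

definition exp_inv :: "nat \<Rightarrow> real \<Rightarrow> real" where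
  "exp_inv k t = (if t > 0 then inverse t ^ k * exp (- inverse t) else 0)"

text \<open>From the right, s = 1/t tends to infinity and s^k / e^s tends to 0; from the left the
  function is identically 0.\<close>

lemma tendsto_exp_inv_0: "(exp_inv k \<longlongrightarrow> 0) (at 0)"
proof -
  have "((\<lambda>t. inverse t ^ k / exp (inverse t)) \<longlongrightarrow> 0) (at_right (0::real))"
    by (rule filterlim_compose[OF tendsto_power_div_exp_0 filterlim_inverse_at_top_right])
  then have "(exp_inv k \<longlongrightarrow> 0) (at_right 0)"
    by (rule Lim_transform_eventually)
      (auto simp: eventually_at_filter exp_inv_def exp_minus divide_inverse)
  moreover have "(exp_inv k \<longlongrightarrow> 0) (at_left 0)"
    by (rule Lim_transform_eventually[OF tendsto_const[of 0]])
      (auto simp: eventually_at_filter exp_inv_def)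
  ultimately show ?thesis
    by (simp add: filterlim_at_split)
qed

text \<open>In s = 1/t the derivative d/dt is -s^2 d/ds, which raises the exponents. At 0 the
  difference quotient of index k is the function of index k + 1, so its limit is already
  known.\<close>

lemma exp_inv_has_real_derivative:
  "(exp_inv k has_real_derivative (exp_inv (k + 2) t - real k * exp_inv (k + 1) t)) (at t)"
proof -
  consider "t > 0" | "t < 0" | "t = 0" by linarith
  then show ?thesis
  proof cases
    case 1
    have "((\<lambda>t. inverse t ^ k * exp (- inverse t)) has_real_derivative
        (exp_inv (k + 2) t - real k * exp_inv (k + 1) t)) (at t)"
    proof -
      define s where "s = inverse t"
      have "((\<lambda>s. s ^ k * exp (- s)) has_real_derivative
          real k * s ^ (k - 1) * exp (- s) - s ^ k * exp (- s)) (at s)"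
        by (auto intro!: derivative_eq_intros)
      then have "((\<lambda>t. inverse t ^ k * exp (- inverse t)) has_real_derivative
          (real k * s ^ (k - 1) * exp (- s) - s ^ k * exp (- s)) * - (s\<^sup>2)) (at t)"
        using DERIV_chain2[OF _ DERIV_inverse, of _ _ t UNIV] 1 by (simp add: s_def numeral_2_eq_2)
      \<comment> \<open>For \<open>k = 0\<close> the truncated exponent \<open>k - 1\<close> is
        harmless, because its term carries the factor k.\<close>
      moreover have "(real k * s ^ (k - 1) * exp (- s) - s ^ k * exp (- s)) * - (s\<^sup>2) =
          exp_inv (k + 2) t - real k * exp_inv (k + 1) t"
        using 1 by (cases k) (simp_all add: exp_inv_def power2_eq_square algebra_simps flip: s_def)
      ultimately show ?thesis by simp
    qed
    then show ?thesis
      by (rule has_field_derivative_transform_within_open[of _ _ _ "{0<..}"])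
        (use 1 in \<open>auto simp: exp_inv_def\<close>)
  next
    case 2
    have "((\<lambda>t. 0) has_real_derivative (exp_inv (k + 2) t - real k * exp_inv (k + 1) t)) (at t)"
      using 2 by (simp add: exp_inv_def)
    then show ?thesis
      by (rule has_field_derivative_transform_within_open[of _ _ _ "{..<0}"])
        (use 2 in \<open>auto simp: exp_inv_def\<close>)
  next
    case 3
    have "((\<lambda>h. exp_inv k h / h) \<longlongrightarrow> 0) (at 0)"
      by (rule Lim_transform_eventually[OF tendsto_exp_inv_0[of "Suc k"]])
        (auto simp: eventually_at_filter exp_inv_def divide_inverse)
    then show ?thesis
      using 3 by (simp add: has_field_derivative_iff exp_inv_def[of _ 0])
  qed
qed

lemma Ck_exp_inv: "Ck n u \<Longrightarrow> Ck n (\<lambda>x. exp_inv k (u x))"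
proof (induction n arbitrary: k)
  case 0
  have "continuous_on UNIV (exp_inv k)"
    by (rule DERIV_continuous_on[OF has_field_derivative_at_within[OF exp_inv_has_real_derivative]])
  then show ?case
    using 0 continuous_on_compose2[of UNIV "exp_inv k" UNIV u] by auto
next
  case (Suc n)
  obtain u' where u': "\<And>x. (u has_derivative u' x) (at x)" "\<And>v. Ck n (\<lambda>x. u' x v)"
    using Suc.prems by (metis Ck_SucE)
  show ?case
  proof (rule Ck_SucI)
    show "((\<lambda>x. exp_inv k (u x)) has_derivative
        (\<lambda>v. u' x v * (exp_inv (k + 2) (u x) - real k * exp_inv (k + 1) (u x)))) (at x)" for x
      using has_derivative_compose[OF u'(1) exp_inv_has_real_derivative[of k "u x", unfolded has_field_derivative_def]]
      by (simp add: mult.commute)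
    show "Ck n (\<lambda>x. u' x v * (exp_inv (k + 2) (u x) - real k * exp_inv (k + 1) (u x)))" for v
      using u'(2) Suc.IH[OF Ck_Suc_imp[OF Suc.prems]]
      by (intro Ck_mult Ck_diff Ck_const) auto
  qed
qed

text \<open>This box contains the ball of radius e outside which the bumps vanish; boxes are the
  domains for the Leibniz rule and for integrals of continuous functions.\<close>

abbreviation cube :: "real \<Rightarrow> 'a::euclidean_space set" where
  "cube e \<equiv> cbox (- (e *\<^sub>R One)) (e *\<^sub>R One)"

lemma mem_cube_norm: "norm x \<le> e \<Longrightarrow> x \<in> cube e"
  unfolding mem_box
proof
  fix i :: 'a assume "i \<in> Basis" "norm x \<le> e"
  then show "- (e *\<^sub>R One) \<bullet> i \<le> x \<bullet> i \<and> x \<bullet> i \<le> e *\<^sub>R One \<bullet> i"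
    using Basis_le_norm[of i x] by (simp add: abs_le_iff)
qed

text \<open>The classical bump exp(-1/(e^2 - |x|^2)) divided by its integral. The integral is
  positive because a continuous nonnegative function with integral 0 vanishes, while the bump is
  nonzero at the origin.\<close>

lemma smooth_bump:
  assumes "e > 0"
  obtains \<rho> :: "'a::euclidean_space \<Rightarrow> real" where "\<And>n. Ck n \<rho>" "\<And>x. 0 \<le> \<rho> x"
    "\<And>x. e \<le> norm x \<Longrightarrow> \<rho> x = 0" "(\<rho> has_integral 1) (cube e)"
proof -
  define h :: "'a \<Rightarrow> real" where "h x = exp_inv 0 (e\<^sup>2 - x \<bullet> x)" for x
  have Ck: "Ck n h" for n
    unfolding h_def
    by (intro Ck_exp_inv Ck_diff Ck_const Ck_bilinear[OF bounded_bilinear_inner] Ck_ident)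
  have nonneg: "0 \<le> h x" for x
    by (simp add: h_def exp_inv_def)
  have zero: "h x = 0" if "e \<le> norm x" for x
    using power_mono[OF that, of 2] assms by (simp add: h_def exp_inv_def power2_norm_eq_inner)
  have "h 0 \<noteq> 0"
    using assms by (simp add: h_def exp_inv_def)
  have cont: "continuous_on (cube e) h"
    using Ck_imp_continuous[OF Ck] continuous_on_subset by blast
  define c where "c = integral (cube e) h"
  have int: "(h has_integral c) (cube e)"
    unfolding c_def using integrable_continuous[OF cont] by (rule integrable_integral)
  have "c \<ge> 0"
    using has_integral_nonneg[OF int] nonneg by blast
  moreover have "c \<noteq> 0"
  proof
    assume "c = 0"
    with int have "(h has_integral 0) (cube e)" by simp
    \<comment> \<open>The interior of the cube must be nonempty: over a degenerate box every
      integral is 0.\<close>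
    moreover have "(0::'a) \<in> box (- (e *\<^sub>R One)) (e *\<^sub>R One)"
      using assms by (auto simp: mem_box)
    moreover from this have "(0::'a) \<in> cube e"
      using box_subset_cbox by blast
    ultimately have "h 0 = 0"
      using has_integral_0_cbox_imp_0[OF cont nonneg] by blast
    with \<open>h 0 \<noteq> 0\<close> show False ..
  qed
  ultimately have "c > 0" by simp
  show ?thesis
  proof
    show "Ck n (\<lambda>x. h x * inverse c)" for n
      by (intro Ck_mult Ck Ck_const)
    show "((\<lambda>x. h x * inverse c) has_integral 1) (cube e)"
      using has_integral_mult_left[OF int, of "inverse c"] \<open>c > 0\<close> by simp
  qed (use nonneg zero \<open>c > 0\<close> in auto)
qed

section \<open>Convolution and differentiation under the integral sign\<close>

lemma convolution_continuous_on_prod: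
  assumes bil: "bounded_bilinear bil" and w: "continuous_on S w" and f: "continuous_on UNIV f"
  shows "continuous_on (UNIV \<times> S) (\<lambda>(x, z). bil (w z) (f (x - z :: 'a::real_normed_vector)))"
  unfolding case_prod_beta
  by (intro bounded_bilinear.continuous_on[OF bil] continuous_on_compose2[OF w]
      continuous_on_compose2[OF f] continuous_intros) auto

lemma convolution_integrable:
  fixes f :: "'a::euclidean_space \<Rightarrow> 'b::real_normed_vector"
    and bil :: "'c::real_normed_vector \<Rightarrow> 'b \<Rightarrow> 'd::euclidean_space"
  assumes bil: "bounded_bilinear bil" and w: "continuous_on (cbox a b) w" and f: "continuous_on UNIV f"
  shows "(\<lambda>z. bil (w z) (f (x - z))) integrable_on cbox a b"
  by (intro integrable_continuous bounded_bilinear.continuous_on[OF bil] w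
      continuous_on_compose2[OF f] continuous_intros) auto

text \<open>The translated factor \<open>f\<close> takes the derivative and the weight
  \<open>w\<close> need only be continuous. With an arbitrary bilinear map, either the field or the
  bump can play the role of \<open>f\<close>: the first choice gives convergence of derivatives, the
  second smoothness.\<close>

lemma convolution_has_derivative:
  fixes f :: "'a::euclidean_space \<Rightarrow> 'b::real_normed_vector"
    and bil :: "'c::real_normed_vector \<Rightarrow> 'b \<Rightarrow> 'd::euclidean_space"
  assumes bil: "bounded_bilinear bil" and w: "continuous_on (cbox a b) w"
    and f: "\<And>x. (f has_derivative f' x) (at x)" and f': "\<And>v. continuous_on UNIV (\<lambda>x. f' x v)"
  shows "((\<lambda>x. integral (cbox a b) (\<lambda>z. bil (w z) (f (x - z)))) has_derivative
    (\<lambda>v. integral (cbox a b) (\<lambda>z. bil (w z) (f' (x - z) v)))) (at x)"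
proof -
  have contf: "continuous_on UNIV f"
    using f by (meson continuous_at_imp_continuous_on has_derivative_continuous)
  \<comment> \<open>The Leibniz rule wants a jointly continuous operator-valued derivative. In
    finite dimension its continuity can be checked direction by direction.\<close>
  define L where "L x z = Blinfun (\<lambda>v. bil (w z) (f' (x - z) v))" for x z
  have bl: "bounded_linear (\<lambda>v. bil (w z) (f' (x - z) v))" for x z
    by (rule bounded_linear_compose[OF bounded_bilinear.bounded_linear_right[OF bil]
          has_derivative_bounded_linear[OF f]])
  have L: "blinfun_apply (L x z) = (\<lambda>v. bil (w z) (f' (x - z) v))" for x z
    unfolding L_def by (rule bounded_linear_Blinfun_apply[OF bl])
  have contL: "continuous_on (UNIV \<times> cbox a b) (\<lambda>(x, z). L x z)"
    unfolding case_prod_beta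
    by (rule continuous_on_blinfun_componentwise)
      (use convolution_continuous_on_prod[OF bil w f'] in \<open>simp add: L case_prod_beta\<close>)
  have "((\<lambda>x. integral (cbox a b) (\<lambda>z. bil (w z) (f (x - z)))) has_derivative
      integral (cbox a b) (L x)) (at x)"
  proof (rule leibniz_rule[where U = UNIV, OF _ _ contL])
    show "((\<lambda>x. bil (w z) (f (x - z))) has_derivative blinfun_apply (L x z)) (at x)" for x z
    proof -
      have "((\<lambda>x. x - z) has_derivative (\<lambda>v. v)) (at x)"
        by (auto intro!: derivative_eq_intros)
      from has_derivative_compose[OF this f] show ?thesis
        unfolding L
        by (intro bounded_linear.has_derivative[OF bounded_bilinear.bounded_linear_right[OF bil]])
    qed
    show "(\<lambda>z. bil (w z) (f (x - z))) integrable_on cbox a b" for x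
      by (rule convolution_integrable[OF bil w contf])
  qed auto
  moreover have "L x integrable_on cbox a b"
    using continuous_on_compose2[OF contL, of "cbox a b" "\<lambda>z. (x, z)"]
    by (intro integrable_continuous) (force intro!: continuous_on_Pair continuous_intros)
  then have "blinfun_apply (integral (cbox a b) (L x)) =
      (\<lambda>v. integral (cbox a b) (\<lambda>z. bil (w z) (f' (x - z) v)))"
    by (simp add: fun_eq_iff blinfun_apply_integral L)
  ultimately show ?thesis by simp
qed

lemma Ck_convolution:
  fixes f :: "'a::euclidean_space \<Rightarrow> 'b::real_normed_vector"
    and bil :: "'c::real_normed_vector \<Rightarrow> 'b \<Rightarrow> 'd::euclidean_space"
  assumes bil: "bounded_bilinear bil" and w: "continuous_on (cbox a b) w"
  shows "Ck n f \<Longrightarrow> Ck n (\<lambda>x. integral (cbox a b) (\<lambda>z. bil (w z) (f (x - z))))"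
proof (induction n arbitrary: f)
  case 0
  then have "continuous_on UNIV f" by simp
  from convolution_continuous_on_prod[OF bil w this] show ?case
    using integral_continuous_on_param[of UNIV a b "\<lambda>x z. bil (w z) (f (x - z))"] by simp
next
  case (Suc n)
  obtain f' where f': "\<And>x. (f has_derivative f' x) (at x)" "\<And>v. Ck n (\<lambda>x. f' x v)"
    using Suc.prems by (metis Ck_SucE)
  show ?case
    by (rule Ck_SucI[OF convolution_has_derivative[OF bil w f'(1) Ck_imp_continuous[OF f'(2)]]
          Suc.IH[OF f'(2)]])
qed

definition mollify :: "real \<Rightarrow> ('a::euclidean_space \<Rightarrow> real) \<Rightarrow> ('a \<Rightarrow> 'b::euclidean_space) \<Rightarrow> 'a \<Rightarrow> 'b" where
  "mollify e \<rho> f x = integral (cube e) (\<lambda>z. \<rho> z *\<^sub>R f (x - z))"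

locale mollifier =
  fixes e :: real and \<rho> :: "'a::euclidean_space \<Rightarrow> real"
  assumes smooth: "\<And>n. Ck n \<rho>" and nonneg: "\<And>x. 0 \<le> \<rho> x"
    and zero: "\<And>x. e \<le> norm x \<Longrightarrow> \<rho> x = 0" and integral_1: "(\<rho> has_integral 1) (cube e)"
begin

lemma cont: "continuous_on S \<rho>"
  using Ck_imp_continuous[OF smooth] continuous_on_subset by blast

lemma mollify_integrable:
  fixes f :: "'a \<Rightarrow> 'b::euclidean_space"
  assumes "continuous_on UNIV f"
  shows "(\<lambda>z. \<rho> z *\<^sub>R f (x - z)) integrable_on cube e"
  by (rule convolution_integrable[OF bounded_bilinear_scaleR cont assms])

text \<open>Substituting y = x - z moves the variable from the field into the bump. Both integrals
  agree with one over the whole space, since the integrand vanishes off the cube through \<rho> and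
  off the box through \<open>f\<close>.\<close>

lemma mollify_eq:
  fixes f :: "'a \<Rightarrow> 'b::euclidean_space"
  assumes f: "continuous_on UNIV f" and supp: "\<And>x. x \<notin> cbox a b \<Longrightarrow> f x = 0"
  shows "mollify e \<rho> f x = integral (cbox a b) (\<lambda>y. \<rho> (x - y) *\<^sub>R f y)"
proof -
  define S where "S = (\<lambda>y. x - y) ` cube e"
  have "((\<lambda>z. \<rho> z *\<^sub>R f (x - z)) has_integral mollify e \<rho> f x) (cube e)"
    unfolding mollify_def by (rule integrable_integral[OF mollify_integrable[OF f]])
  from has_integral_affinity[OF this, of "-1" x]
  have "((\<lambda>y. \<rho> (x - y) *\<^sub>R f y) has_integral mollify e \<rho> f x) S"
    by (simp add: S_def)
  moreover have "\<rho> (x - y) *\<^sub>R f y = 0" if "y \<notin> S" for y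
  proof -
    have "x - y \<notin> cube e"
      using that unfolding S_def by (metis (no_types, lifting) image_eqI diff_diff_eq2 add_diff_cancel_left')
    then have "e \<le> norm (x - y)"
      using mem_cube_norm[of "x - y" e] by linarith
    then show ?thesis by (simp add: zero)
  qed
  ultimately have 1: "((\<lambda>y. \<rho> (x - y) *\<^sub>R f y) has_integral mollify e \<rho> f x) UNIV"
    by (rule has_integral_on_superset) auto
  have "(\<lambda>y. \<rho> (x - y) *\<^sub>R f y) integrable_on cbox a b"
    by (intro integrable_continuous continuous_intros continuous_on_compose2[OF cont[of UNIV]]
        continuous_on_subset[OF f]) auto
  then have "((\<lambda>y. \<rho> (x - y) *\<^sub>R f y) has_integral
      integral (cbox a b) (\<lambda>y. \<rho> (x - y) *\<^sub>R f y)) UNIV"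
    by (intro has_integral_on_superset[OF integrable_integral]) (auto simp: supp)
  then show ?thesis
    using has_integral_unique[OF 1] by blast
qed

text \<open>Once the variable sits in the bump, the merely continuous \<open>f\<close> acts as a
  weight on a fixed box and all derivatives fall on \<rho>; hence the flipped scalar
  multiplication.\<close>

lemma Ck_mollify:
  fixes f :: "'a \<Rightarrow> 'b::euclidean_space"
  assumes f: "continuous_on UNIV f" and K: "compact K" and supp: "\<And>x. x \<notin> K \<Longrightarrow> f x = 0"
  shows "Ck n (mollify e \<rho> f)"
proof -
  obtain a b where K': "K \<subseteq> cbox a b"
    using bounded_subset_cbox_symmetric[OF compact_imp_bounded[OF K]] by blast
  have "Ck n (\<lambda>x. integral (cbox a b) (\<lambda>y. \<rho> (x - y) *\<^sub>R f y))"
    by (rule Ck_convolution[OF bounded_bilinear.flip[OF bounded_bilinear_scaleR]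
          continuous_on_subset[OF f] smooth]) simp
  also have "(\<lambda>x. integral (cbox a b) (\<lambda>y. \<rho> (x - y) *\<^sub>R f y)) = mollify e \<rho> f"
  proof
    fix x
    have "f y = 0" if "y \<notin> cbox a b" for y
      using supp K' that by blast
    from mollify_eq[OF f this]
    show "integral (cbox a b) (\<lambda>y. \<rho> (x - y) *\<^sub>R f y) = mollify e \<rho> f x" by simp
  qed
  finally show ?thesis .
qed

lemma mollify_zero_outside:
  assumes supp: "\<And>x. x \<notin> K \<Longrightarrow> f x = 0" and x: "\<And>y. y \<in> K \<Longrightarrow> e \<le> dist x y"
  shows "mollify e \<rho> f x = 0"
proof -
  have "\<rho> z *\<^sub>R f (x - z) = 0" for z
    using x[of "x - z"] zero[of z] supp[of "x - z"] by (cases "x - z \<in> K") (auto simp: dist_norm)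
  then show ?thesis
    by (simp add: mollify_def del: scaleR_eq_0_iff)
qed

text \<open>Since \<rho> has mass 1, the difference is the average of f(x - z) - f(x) with weights
  \<rho>, and only |z| < e contributes.\<close>

lemma dist_mollify_le:
  fixes f :: "'a \<Rightarrow> 'b::euclidean_space"
  assumes f: "continuous_on UNIV f" and d: "\<And>z. norm z < e \<Longrightarrow> dist (f (x - z)) (f x) \<le> d"
  shows "dist (mollify e \<rho> f x) (f x) \<le> d"
proof -
  have "((\<lambda>z. \<rho> z *\<^sub>R f (x - z) - \<rho> z *\<^sub>R f x) has_integral (mollify e \<rho> f x - 1 *\<^sub>R f x)) (cube e)"
    unfolding mollify_def
    by (intro has_integral_diff integrable_integral mollify_integrable[OF f] has_integral_scaleR_left
        integral_1)
  moreover have "((\<lambda>z. \<rho> z * d) has_integral 1 * d) (cube e)"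
    by (rule has_integral_mult_left[OF integral_1])
  moreover have "norm (\<rho> z *\<^sub>R f (x - z) - \<rho> z *\<^sub>R f x) \<le> \<rho> z * d" for z
  proof (cases "norm z < e")
    case True
    then show ?thesis
      using d[OF True] nonneg[of z] by (simp add: dist_norm mult_left_mono flip: scaleR_diff_right)
  next
    case False
    then show ?thesis by (simp add: zero)
  qed
  ultimately have "norm (mollify e \<rho> f x - 1 *\<^sub>R f x) \<le> 1 * d"
    using Henstock_Kurzweil_Integration.integral_norm_bound_integral has_integral_iff
    by (metis (no_types, lifting))
  then show ?thesis
    by (simp add: dist_norm)
qed

lemma mollify_has_derivative:
  fixes f :: "'a \<Rightarrow> 'b::euclidean_space"
  assumes f: "\<And>x. (f has_derivative f' x) (at x)" and f': "\<And>v. continuous_on UNIV (\<lambda>x. f' x v)"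
  shows "(mollify e \<rho> f has_derivative (\<lambda>v. mollify e \<rho> (\<lambda>x. f' x v) x)) (at x)"
  unfolding mollify_def[abs_def]
  by (rule convolution_has_derivative[OF bounded_bilinear_scaleR cont f f'])

end

text \<open>Uniform continuity holds on the compact 1-thickening of \<open>K\<close>. Two points
  less than \<open>min r 1\<close> apart either both lie in it or both avoid \<open>K\<close>, where
  \<open>f\<close> is 0.\<close>

lemma uniformly_continuous_compact_support:
  fixes f :: "'a::euclidean_space \<Rightarrow> 'b::real_normed_vector"
  assumes f: "continuous_on UNIV f" and K: "compact K" and supp: "\<And>x. x \<notin> K \<Longrightarrow> f x = 0" and "d > 0"
  obtains r where "r > 0" "\<And>x y. dist x y < r \<Longrightarrow> dist (f x) (f y) < d"
proof -
  define K' where "K' = {x + y |x y. x \<in> K \<and> y \<in> cball 0 1}"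
  have "compact K'"
    unfolding K'_def by (rule compact_sums[OF K compact_cball])
  then have "uniformly_continuous_on K' f"
    using compact_uniformly_continuous continuous_on_subset[OF f] by blast
  then obtain r where r: "r > 0" "\<And>x y. x \<in> K' \<Longrightarrow> y \<in> K' \<Longrightarrow> dist x y < r \<Longrightarrow> dist (f x) (f y) < d"
    using \<open>d > 0\<close> unfolding uniformly_continuous_on_def by (metis dist_commute)
  have K': "y \<in> K'" if "x \<in> K" "dist x y \<le> 1" for x y
    unfolding K'_def using that
    by (intro CollectI exI[of _ x] exI[of _ "y - x"]) (auto simp: dist_norm norm_minus_commute)
  show ?thesis
  proof
    show "min r 1 > 0" using r by simp
    fix x y :: 'a assume *: "dist x y < min r 1"
    show "dist (f x) (f y) < d"
    proof (cases "x \<in> K \<or> y \<in> K")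
      case True
      then have "x \<in> K' \<and> y \<in> K'"
        using K'[of x x] K'[of x y] K'[of y x] K'[of y y] * by (auto simp: dist_commute)
      then show ?thesis
        using r(2) * by simp
    next
      case False
      then show ?thesis using supp \<open>d > 0\<close> by simp
    qed
  qed
qed

text \<open>Mollification commutes with differentiation, so the derivative of the error is the error
  for the derivative, and only the uniform estimate has to be proved.\<close>

lemma mollify_null_Ck:
  fixes f :: "'a::euclidean_space \<Rightarrow> 'b::euclidean_space"
  assumes mol: "\<And>m. mollifier (e m) (\<rho> m)" and e: "e \<longlonglongrightarrow> 0" and K: "compact K"
  shows "Ck n f \<Longrightarrow> (\<And>x. x \<notin> K \<Longrightarrow> f x = 0) \<Longrightarrow>
    null_Ck n (\<lambda>m x. mollify (e m) (\<rho> m) f x - f x)"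
proof (induction n arbitrary: f)
  have ul: "uniform_limit UNIV (\<lambda>m x. mollify (e m) (\<rho> m) f x - f x) (\<lambda>x. 0) sequentially"
    if f: "continuous_on UNIV f" and supp: "\<And>x. x \<notin> K \<Longrightarrow> f x = 0" for f :: "'a \<Rightarrow> 'b"
  proof (rule uniform_limitI)
    fix d :: real assume "d > 0"
    \<comment> \<open>Averaging yields only a weak inequality; half of \<open>d\<close> restores the
      strict one.\<close>
    obtain r where r: "r > 0" "\<And>x y. dist x y < r \<Longrightarrow> dist (f x) (f y) < d / 2"
      by (rule uniformly_continuous_compact_support[OF f K, of "d / 2"])
        (use supp \<open>d > 0\<close> in auto)
    have "\<forall>\<^sub>F m in sequentially. e m < r"
      using order_tendstoD(2)[OF e r(1)] .
    then show "\<forall>\<^sub>F m in sequentially. \<forall>x\<in>UNIV. dist (mollify (e m) (\<rho> m) f x - f x) 0 < d"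
    proof eventually_elim
      case (elim m)
      interpret mollifier "e m" "\<rho> m" by (rule mol)
      have le: "dist (mollify (e m) (\<rho> m) f x) (f x) \<le> d / 2" for x
      proof (rule dist_mollify_le[OF f])
        fix z :: 'a assume "norm z < e m"
        then have "dist (x - z) x < r"
          using elim by (simp add: dist_norm)
        from r(2)[OF this] show "dist (f (x - z)) (f x) \<le> d / 2" by simp
      qed
      show ?case
      proof
        fix x
        show "dist (mollify (e m) (\<rho> m) f x - f x) 0 < d"
          using le[of x] \<open>d > 0\<close> by (simp add: dist_norm)
      qed
    qed
  qed
  {
    case 0
    then have f: "continuous_on UNIV f" by simp
    have "continuous_on UNIV (\<lambda>x. mollify (e m) (\<rho> m) f x - f x)" for m
      using Ck_imp_continuous[OF mollifier.Ck_mollify[OF mol f K "0.prems"(2)]] f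
      by (intro continuous_intros) auto
    with ul[OF f "0.prems"(2)] show ?case by simp
  next
    case (Suc n)
    obtain f' where f': "\<And>x. (f has_derivative f' x) (at x)" "\<And>v. Ck n (\<lambda>x. f' x v)"
      using Suc.prems(1) by (metis Ck_SucE)
    have supp': "f' x v = 0" if "x \<notin> K" for x v
      using has_derivative_zero_outside[OF f'(1) compact_imp_closed[OF K] Suc.prems(2) that] .
    show ?case
    proof (rule null_Ck_SucI)
      show "((\<lambda>x. mollify (e m) (\<rho> m) f x - f x) has_derivative
          (\<lambda>v. mollify (e m) (\<rho> m) (\<lambda>x. f' x v) x - f' x v)) (at x)" for m x
        by (intro has_derivative_diff f'(1)
            mollifier.mollify_has_derivative[OF mol f'(1) Ck_imp_continuous[OF f'(2)]])
      show "uniform_limit UNIV (\<lambda>m x. mollify (e m) (\<rho> m) f x - f x) (\<lambda>x. 0) sequentially"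
        by (rule ul[OF Ck_imp_continuous[OF Suc.prems(1)] Suc.prems(2)])
      show "null_Ck n (\<lambda>m x. mollify (e m) (\<rho> m) (\<lambda>x. f' x v) x - f' x v)" for v
        by (rule Suc.IH[OF f'(2) supp'])
    qed
  }
qed

subsection \<open>Test functions\<close>

text \<open>One sequence serves every order \<open>n\<close> at once, as infinite k requires. The
  radii 1/(m+1) are at most 1, so all supports lie in the compact 1-thickening of
  \<open>K\<close>.\<close>

lemma smooth_approximation:
  fixes g :: "'a::euclidean_space \<Rightarrow> 'b::euclidean_space"
  assumes cont: "continuous_on UNIV g" and K: "compact K" and supp: "\<And>x. x \<notin> K \<Longrightarrow> g x = 0"
  obtains h K' where "compact K'" "\<And>x. x \<notin> K' \<Longrightarrow> g x = 0" "\<And>m x. x \<notin> K' \<Longrightarrow> h m x = 0"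
    "\<And>m n. Ck n (h m)" "\<And>n. Ck n g \<Longrightarrow> null_Ck n (\<lambda>m x. h m x - g x)"
proof -
  define e where "e m = inverse (real (Suc m))" for m
  have e: "e m > 0" "e m \<le> 1" "e \<longlonglongrightarrow> 0" for m
    using LIMSEQ_inverse_real_of_nat unfolding e_def[abs_def] by (simp_all add: divide_simps)
  have "\<exists>\<rho>. mollifier (e m) (\<rho> :: 'a \<Rightarrow> real)" for m
    using smooth_bump[OF e(1)[of m]] unfolding mollifier_def by metis
  then obtain \<rho> :: "nat \<Rightarrow> 'a \<Rightarrow> real" where \<rho>: "\<And>m. mollifier (e m) (\<rho> m)"
    by metis
  define K' where "K' = {x + y |x y. x \<in> K \<and> y \<in> cball 0 1}"
  have K': "x \<in> K'" if "y \<in> K" "dist x y \<le> 1" for x y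
  proof -
    have "x = y + (x - y)" "x - y \<in> cball 0 1"
      using that by (auto simp: dist_norm norm_minus_commute)
    with that(1) show ?thesis
      unfolding K'_def by blast
  qed
  show ?thesis
  proof
    show "compact K'"
      unfolding K'_def by (rule compact_sums[OF K compact_cball])
    show "g x = 0" if "x \<notin> K'" for x
      using K'[of x x] that supp by auto
    show "mollify (e m) (\<rho> m) g x = 0" if "x \<notin> K'" for m x
    proof (rule mollifier.mollify_zero_outside[OF \<rho> supp])
      show "e m \<le> dist x y" if "y \<in> K" for y
        using K'[OF that, of x] \<open>x \<notin> K'\<close> e(2)[of m] by linarith
    qed
    show "Ck n (mollify (e m) (\<rho> m) g)" for m n
      by (rule mollifier.Ck_mollify[OF \<rho> cont K supp])
    show "null_Ck n (\<lambda>m x. mollify (e m) (\<rho> m) g x - g x)" if "Ck n g" for n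
      by (rule mollify_null_Ck[OF \<rho> e(3) K that supp])
  qed
qed

text \<open>The quotient a/(a + b), where \<open>a\<close> is positive exactly inside radius R + 1
  and \<open>b\<close> exactly outside radius R; the denominator never vanishes because these
  regions cover the space.\<close>

lemma smooth_cutoff:
  assumes "R > 0"
  obtains \<eta> :: "'a::euclidean_space \<Rightarrow> real" where "\<And>n. Ck n \<eta>" "\<And>x. norm x \<le> R \<Longrightarrow> \<eta> x = 1"
    "\<And>x. R + 1 \<le> norm x \<Longrightarrow> \<eta> x = 0"
proof -
  define a b :: "'a \<Rightarrow> real" where
    "a x = exp_inv 0 ((R + 1)\<^sup>2 - x \<bullet> x)" and "b x = exp_inv 0 (x \<bullet> x - R\<^sup>2)" for x
  have Ck: "Ck n a" "Ck n b" for n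
    unfolding a_def b_def
    by (intro Ck_exp_inv Ck_diff Ck_const Ck_bilinear[OF bounded_bilinear_inner] Ck_ident)+
  have nonneg: "a x \<ge> 0" "b x \<ge> 0" for x
    by (auto simp: a_def b_def exp_inv_def)
  have a0: "a x = 0" if "R + 1 \<le> norm x" for x
    using power_mono[OF that, of 2] assms by (simp add: a_def exp_inv_def power2_norm_eq_inner)
  have apos: "a x > 0" if "norm x < R + 1" for x
    using power_strict_mono[OF that, of 2] by (simp add: a_def exp_inv_def power2_norm_eq_inner)
  have b0: "b x = 0" if "norm x \<le> R" for x
    using power_mono[OF that, of 2] by (simp add: b_def exp_inv_def power2_norm_eq_inner)
  have bpos: "b x > 0" if "R < norm x" for x
    using power_strict_mono[OF that, of 2] assms
    by (simp add: b_def exp_inv_def power2_norm_eq_inner)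
  have pos: "a x + b x > 0" for x
    using apos[of x] bpos[of x] nonneg[of x] by (cases "norm x < R + 1") auto
  show ?thesis
  proof
    show "Ck n (\<lambda>x. a x * inverse (a x + b x))" for n
      using pos by (intro Ck_mult Ck_inverse Ck_add Ck) (metis less_irrefl)
    show "a x * inverse (a x + b x) = 1" if "norm x \<le> R" for x
      using b0[OF that] apos[of x] that by simp
  qed (simp add: a0)
qed

lemma test_space_iff:
  fixes f :: "'a::euclidean_space \<Rightarrow> 'b::real_normed_vector"
  shows "f \<in> test_space k \<longleftrightarrow>
    (\<forall>n. enat n \<le> k \<longrightarrow> Ck n f) \<and> (\<exists>K. compact K \<and> (\<forall>x. x \<notin> K \<longrightarrow> f x = 0))"
proof -
  have "compact (closure (support_on UNIV f)) \<longleftrightarrow> (\<exists>K. compact K \<and> (\<forall>x. x \<notin> K \<longrightarrow> f x = 0))"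
  proof
    assume "compact (closure (support_on UNIV f))"
    moreover have "f x = 0" if "x \<notin> closure (support_on UNIV f)" for x
      using that closure_subset[of "support_on UNIV f"] by (auto simp: support_on_def)
    ultimately show "\<exists>K. compact K \<and> (\<forall>x. x \<notin> K \<longrightarrow> f x = 0)"
      by blast
  next
    assume "\<exists>K. compact K \<and> (\<forall>x. x \<notin> K \<longrightarrow> f x = 0)"
    then obtain K where "compact K" "support_on UNIV f \<subseteq> K"
      by (auto simp: support_on_def)
    then show "compact (closure (support_on UNIV f))"
      by (meson bounded_subset compact_closure compact_imp_bounded)
  qed
  then show ?thesis
    by (simp add: test_space_def class_C_iff_Ck)
qed

lemma dderivs_uniform_limit_diff_iff:
  assumes "\<And>m. Ck n (\<phi> m)" "Ck n \<psi>" "length vs \<le> n"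
  shows "uniform_limit UNIV (\<lambda>m. dderivs vs (\<lambda>x. \<phi> m x - \<psi> x)) (\<lambda>x. 0) F \<longleftrightarrow>
    uniform_limit UNIV (\<lambda>m. dderivs vs (\<phi> m)) (dderivs vs \<psi>) F"
proof -
  have "dderivs vs (\<phi> m) = (\<lambda>x. dderivs vs (\<lambda>x. \<phi> m x - \<psi> x) x + dderivs vs \<psi> x)" for m
    using Ck_dderivs_add[OF Ck_diff[OF assms(1,2)] assms(2,3), of m] by simp
  then show ?thesis
    by (simp add: uniform_limit_iff dist_norm)
qed

lemma test_converges_iff:
  fixes \<phi> :: "nat \<Rightarrow> 'a::euclidean_space \<Rightarrow> 'b::real_normed_vector"
  assumes \<phi>: "\<And>m. \<phi> m \<in> test_space k" and \<psi>: "\<psi> \<in> test_space k"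
  shows "test_converges k \<phi> \<psi> \<longleftrightarrow>
    (\<exists>K. compact K \<and> (\<forall>m x. x \<notin> K \<longrightarrow> \<phi> m x = 0)) \<and>
    (\<forall>n. enat n \<le> k \<longrightarrow> null_Ck n (\<lambda>m x. \<phi> m x - \<psi> x))"
proof -
  have Ck: "Ck n (\<phi> m)" "Ck n \<psi>" if "enat n \<le> k" for n m
    using \<phi> \<psi> that by (auto simp: test_space_iff)
  have "(\<forall>vs. enat (length vs) \<le> k \<longrightarrow>
        uniform_limit UNIV (\<lambda>m. dderivs vs (\<phi> m)) (dderivs vs \<psi>) sequentially) \<longleftrightarrow>
      (\<forall>n. enat n \<le> k \<longrightarrow> null_Ck n (\<lambda>m x. \<phi> m x - \<psi> x))" (is "?L \<longleftrightarrow> ?R")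
  proof
    assume L: ?L
    show ?R
      unfolding null_Ck_iff_dderivs
    proof (intro allI impI conjI)
      fix n m assume n: "enat n \<le> k"
      show "Ck n (\<lambda>x. \<phi> m x - \<psi> x)"
        by (intro Ck_diff Ck n)
      fix vs :: "'a list" assume vs: "length vs \<le> n"
      then have "enat (length vs) \<le> k"
        using n by (metis enat_ord_simps(1) order_trans)
      with L show "uniform_limit UNIV (\<lambda>m. dderivs vs (\<lambda>x. \<phi> m x - \<psi> x)) (\<lambda>x. 0) sequentially"
        using dderivs_uniform_limit_diff_iff[where \<phi> = \<phi>, OF Ck[OF n] vs] by blast
    qed
  next
    assume R: ?R
    show ?L
    proof (intro allI impI)
      fix vs :: "'a list" assume vs: "enat (length vs) \<le> k"
      with R have "uniform_limit UNIV (\<lambda>m. dderivs vs (\<lambda>x. \<phi> m x - \<psi> x)) (\<lambda>x. 0) sequentially"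
        unfolding null_Ck_iff_dderivs by blast
      then show "uniform_limit UNIV (\<lambda>m. dderivs vs (\<phi> m)) (dderivs vs \<psi>) sequentially"
        using dderivs_uniform_limit_diff_iff[where \<phi> = \<phi>, OF Ck[OF vs] order_refl] by blast
    qed
  qed
  moreover have "(\<forall>m. support_on UNIV (\<phi> m) \<subseteq> K) \<longleftrightarrow> (\<forall>m x. x \<notin> K \<longrightarrow> \<phi> m x = 0)" for K
    by (auto simp: support_on_def)
  ultimately show ?thesis
    by (simp add: test_converges_def)
qed

text \<open>\<open>test_converges\<close> bounds the supports of the sequence only. The empty list
  of directions gives pointwise convergence, so the limit vanishes off the same set.\<close>

lemma test_converges_support_limit:
  assumes "test_converges k \<phi> \<psi>" "\<And>m x. x \<notin> K \<Longrightarrow> \<phi> m x = 0" "x \<notin> K"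
  shows "\<psi> x = 0"
proof -
  have "uniform_limit UNIV (\<lambda>m. dderivs [] (\<phi> m)) (dderivs [] \<psi>) sequentially"
    using assms(1) unfolding test_converges_def by (metis list.size(3) zero_enat_def zero_le)
  then have "(\<lambda>m. \<phi> m x) \<longlonglongrightarrow> \<psi> x"
    using tendsto_uniform_limitI by fastforce
  then show ?thesis
    using LIMSEQ_unique[OF _ tendsto_const[of 0]] assms(2,3) by simp
qed

subsection \<open>Matrices, gradients and Hessians\<close>

lemma matrix_eq_sum_columns:
  fixes A :: "real ^ 'n ^ 'm"
  shows "A = (\<Sum>j\<in>UNIV. \<chi> i k. if k = j then (A *v axis j 1) $ i else 0)"
  by (simp add: vec_eq_iff matrix_vector_mult_basis column_def)

lemma bounded_linear_single_column:
  "bounded_linear (\<lambda>v :: real ^ 'm. (\<chi> i k. if k = j then v $ i else 0) :: real ^ 'n ^ 'm)"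
  by (rule linear_conv_bounded_linear[THEN iffD1], rule linearI) (auto simp: vec_eq_iff)

text \<open>A matrix is a sum of linear images of its columns, so regularity of the directional
  values suffices.\<close>

lemma Ck_matrix:
  fixes A :: "'a::euclidean_space \<Rightarrow> real ^ 'n ^ 'm"
  assumes "\<And>v. Ck n (\<lambda>x. A x *v v)"
  shows "Ck n A"
proof -
  have "Ck n (\<lambda>x. \<Sum>j\<in>UNIV. \<chi> i k. if k = j then (A x *v axis j 1) $ i else 0)"
    by (intro Ck_sum Ck_linear[OF bounded_linear_single_column] assms)
  then show ?thesis
    by (simp flip: matrix_eq_sum_columns)
qed

lemma null_Ck_matrix:
  fixes A :: "nat \<Rightarrow> 'a::euclidean_space \<Rightarrow> real ^ 'n ^ 'm"
  assumes "\<And>v. null_Ck n (\<lambda>m x. A m x *v v)"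
  shows "null_Ck n A"
proof -
  have "null_Ck n (\<lambda>m x. \<Sum>j\<in>UNIV. \<chi> i k. if k = j then (A m x *v axis j 1) $ i else 0)"
    by (intro null_Ck_sum null_Ck_linear[OF bounded_linear_single_column] assms)
  then show ?thesis
    by (simp flip: matrix_eq_sum_columns)
qed

lemma bounded_bilinear_matrix_mult:
  "bounded_bilinear ((**) :: real ^ 'n ^ 'm \<Rightarrow> real ^ 'p ^ 'n \<Rightarrow> real ^ 'p ^ 'm)"
  unfolding bilinear_conv_bounded_bilinear[symmetric] bilinear_def
  by (auto intro!: linearI simp: vec_eq_iff matrix_matrix_mult_def sum.distrib algebra_simps
      sum_distrib_left)

lemma hs_inner_eq_inner: "hs_inner A B = A \<bullet> B"
  unfolding hs_inner_def trace_def matrix_matrix_mult_def transpose_def inner_vec_def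
  by (subst sum.swap) simp

lemma hs_inner_mult_transpose: "hs_inner A (B ** transpose C) = hs_inner (A ** C) B"
  unfolding hs_inner_def matrix_transpose_mul
  by (metis matrix_mul_assoc trace_mul_sym)

lemma jacobian_eq:
  fixes f :: "real ^ 'n \<Rightarrow> real ^ 'm"
  assumes "(f has_derivative (\<lambda>v. A *v v)) (at x)"
  shows "jacobian f (at x) = A"
  unfolding jacobian_def using frechet_derivative_at[OF assms] by (metis matrix_of_matrix_vector_mul)

lemma Ck_Suc_has_derivative_jacobian:
  fixes f :: "real ^ 'n \<Rightarrow> real ^ 'm"
  assumes "Ck (Suc n) f"
  shows "(f has_derivative (\<lambda>v. jacobian f (at x) *v v)) (at x)"
  using assms jacobian_works[of f "at x"] by (auto simp: differentiable_on_def)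

lemma Ck_jacobian:
  fixes f :: "real ^ 'n \<Rightarrow> real ^ 'm"
  assumes "Ck (Suc n) f"
  shows "Ck n (\<lambda>x. jacobian f (at x))"
proof (rule Ck_matrix)
  fix v
  show "Ck n (\<lambda>x. jacobian f (at x) *v v)"
    using assms frechet_derivative_at[OF Ck_Suc_has_derivative_jacobian[OF assms]] by simp
qed

lemma null_Ck_jacobian:
  fixes \<theta> :: "nat \<Rightarrow> real ^ 'n \<Rightarrow> real ^ 'm"
  assumes "null_Ck (Suc n) \<theta>"
  shows "null_Ck n (\<lambda>m x. jacobian (\<theta> m) (at x))"
proof (rule null_Ck_matrix)
  fix v
  show "null_Ck n (\<lambda>m x. jacobian (\<theta> m) (at x) *v v)"
    using assms frechet_derivative_at[OF Ck_Suc_has_derivative_jacobian[OF null_Ck_imp_Ck[OF assms]]]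
    by simp
qed

lemma jacobian_diff:
  fixes f g :: "real ^ 'n \<Rightarrow> real ^ 'm"
  assumes "Ck (Suc 0) f" "Ck (Suc 0) g"
  shows "jacobian (\<lambda>x. f x - g x) (at x) = jacobian f (at x) - jacobian g (at x)"
  by (rule jacobian_eq)
    (use has_derivative_diff[OF assms[THEN Ck_Suc_has_derivative_jacobian]] in
      \<open>simp add: matrix_vector_mult_diff_rdistrib\<close>)

lemma jacobian_zero_outside:
  fixes f :: "real ^ 'n \<Rightarrow> real ^ 'm"
  assumes "Ck (Suc 0) f" "closed K" "\<And>y. y \<notin> K \<Longrightarrow> f y = 0" "x \<notin> K"
  shows "jacobian f (at x) = 0"
  using has_derivative_zero_outside[OF Ck_Suc_has_derivative_jacobian[OF assms(1)] assms(2-4)]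
  by (metis matrix_eq matrix_vector_mult_0)

text \<open>\<open>grad\<close> is a definite description, so uniqueness of the Riesz representative
  is part of the proof. The formula by partial derivatives shows that the gradient loses exactly one
  order.\<close>

lemma has_derivative_grad:
  fixes f :: "'a::euclidean_space \<Rightarrow> real"
  assumes "(f has_derivative f') (at x)"
  shows "grad f x = (\<Sum>b\<in>Basis. f' b *\<^sub>R b)"
proof -
  interpret bounded_linear f'
    using assms by (rule has_derivative_bounded_linear)
  let ?D = "\<Sum>b\<in>Basis. f' b *\<^sub>R b"
  have f': "f' = (\<lambda>h. h \<bullet> ?D)"
  proof
    fix h
    have "f' h = f' (\<Sum>b\<in>Basis. (h \<bullet> b) *\<^sub>R b)"
      by (simp add: euclidean_representation)
    also have "\<dots> = h \<bullet> ?D"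
      by (simp add: sum scaleR inner_sum_right mult.commute)
    finally show "f' h = h \<bullet> ?D" .
  qed
  show ?thesis
    unfolding grad_def gderiv_def
  proof (rule the_equality)
    show "(f has_derivative (\<lambda>h. h \<bullet> ?D)) (at x)"
      using assms f' by metis
    fix D assume "(f has_derivative (\<lambda>h. h \<bullet> D)) (at x)"
    then have "(\<lambda>h. h \<bullet> D) = (\<lambda>h. h \<bullet> ?D)"
      using has_derivative_unique[OF assms] f' by metis
    then show "D = ?D"
      by (metis inner_commute vector_eq_ldot)
  qed
qed

lemma Ck_grad:
  assumes "Ck (Suc n) f"
  shows "Ck n (grad f)"
proof -
  obtain f' where f': "\<And>x. (f has_derivative f' x) (at x)" "\<And>v. Ck n (\<lambda>x. f' x v)"
    using assms by (metis Ck_SucE)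
  have "grad f = (\<lambda>x. \<Sum>b\<in>Basis. f' x b *\<^sub>R b)"
    using has_derivative_grad[OF f'(1)] by (rule ext)
  then show ?thesis
    by (simp add: Ck_sum Ck_scaleR Ck_const f'(2))
qed

lemma pos_def_invertible:
  assumes "pos_def A"
  shows "invertible A"
  unfolding invertible_left_inverse matrix_left_invertible_ker
  using assms unfolding pos_def_def by (metis inner_zero_right less_irrefl)

lemma transpose_matrix_inv_symmetric:
  fixes A :: "real ^ 'n ^ 'n"
  assumes "invertible A" "transpose A = A"
  shows "transpose (matrix_inv A) = matrix_inv A"
proof -
  have "transpose (matrix_inv A) ** A = mat 1"
    using arg_cong[OF matrix_inv_inverse(1)[OF assms(1)], of transpose] assms(2)
    by (simp add: matrix_transpose_mul transpose_mat)
  then show ?thesis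
    by (metis matrix_inv_inverse(1)[OF assms(1)] matrix_mul_assoc matrix_mul_lid matrix_mul_rid)
qed

text \<open>Along the segment from x to y with direction w, the scalar function w . F has derivative
  w . H w > 0. By the mean value theorem it cannot take the same value at both ends.\<close>

lemma inj_if_pos_def_derivative:
  fixes F :: "real ^ 'n \<Rightarrow> real ^ 'n"
  assumes F: "\<And>x. (F has_derivative (\<lambda>v. H x *v v)) (at x)" and H: "\<And>x. pos_def (H x)"
  shows "inj F"
proof (rule injI, rule ccontr)
  fix x y assume eq: "F x = F y" and ne: "x \<noteq> y"
  define w where "w = y - x"
  define \<phi> where "\<phi> t = w \<bullet> F (x + t *\<^sub>R w)" for t :: real
  have \<phi>': "(\<phi> has_real_derivative w \<bullet> (H (x + t *\<^sub>R w) *v w)) (at t)" for t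
  proof -
    have "((\<lambda>t. x + t *\<^sub>R w) has_derivative (\<lambda>s. s *\<^sub>R w)) (at t)"
      by (auto intro!: derivative_eq_intros)
    from has_derivative_inner_right[OF has_derivative_compose[OF this F]]
    show ?thesis
      unfolding \<phi>_def has_field_derivative_def
      by (simp add: matrix_vector_mult_scaleR mult_commute_abs)
  qed
  obtain z where "\<phi> 1 - \<phi> 0 = (1 - 0) * (w \<bullet> (H (x + z *\<^sub>R w) *v w))"
    using MVT2[OF zero_less_one \<phi>'] by auto
  moreover have "w \<bullet> (H (x + z *\<^sub>R w) *v w) > 0"
    using H ne unfolding pos_def_def w_def by (metis right_minus_eq)
  moreover have "\<phi> 1 = \<phi> 0"
    using eq by (simp add: \<phi>_def w_def)
  ultimately show False by simp
qed

subsection \<open>Extending the Stein identity to test functions of finite order\<close>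

lemma integral_inner_null:
  fixes w :: "'a \<Rightarrow> 'b::euclidean_space"
  assumes w: "integrable M w" and \<theta>: "uniform_limit UNIV \<theta> (\<lambda>x. 0) sequentially"
  shows "(\<lambda>m. \<integral>x. w x \<bullet> \<theta> m x \<partial>M) \<longlonglongrightarrow> 0"
proof (rule tendstoI)
  fix d :: real assume "d > 0"
  define C where "C = (\<integral>x. norm (w x) \<partial>M)"
  have "C \<ge> 0" by (simp add: C_def)
  \<comment> \<open>The added 1 keeps the denominator positive when \<open>w\<close> vanishes almost
    everywhere.\<close>
  define r where "r = d / (C + 1)"
  have "r > 0" and rC: "r * C < d"
    using \<open>d > 0\<close> \<open>C \<ge> 0\<close> by (auto simp: r_def field_simps)
  from uniform_limitD[OF \<theta> \<open>r > 0\<close>]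
  show "\<forall>\<^sub>F m in sequentially. dist (\<integral>x. w x \<bullet> \<theta> m x \<partial>M) 0 < d"
  proof eventually_elim
    case (elim m)
    have "norm (\<integral>x. w x \<bullet> \<theta> m x \<partial>M) \<le> (\<integral>x. norm (w x \<bullet> \<theta> m x) \<partial>M)"
      by (rule integral_norm_bound)
    also have "\<dots> \<le> (\<integral>x. norm (w x) * r \<partial>M)"
    proof (rule integral_mono')
      show "integrable M (\<lambda>x. norm (w x) * r)"
        using w by simp
      fix x
      have "norm (w x \<bullet> \<theta> m x) \<le> norm (w x) * norm (\<theta> m x)"
        by (simp add: Cauchy_Schwarz_ineq2)
      also have "\<dots> \<le> norm (w x) * r"
        using elim by (intro mult_left_mono) (auto simp: less_imp_le)
      finally show "norm (w x \<bullet> \<theta> m x) \<le> norm (w x) * r" .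
    qed (use \<open>r > 0\<close> in simp)
    also have "\<dots> = r * C"
      by (simp add: C_def mult.commute)
    finally show ?case
      using rC by simp
  qed
qed

text \<open>A compactly supported continuous \<open>h\<close> is bounded, and replacing
  \<open>w\<close> by its restriction to \<open>K\<close> leaves the product unchanged.\<close>

lemma integrable_inner_compact_support:
  fixes w :: "'a::euclidean_space \<Rightarrow> 'b::euclidean_space"
  assumes M: "sets M = sets borel" and w: "integrable M (\<lambda>x. indicator K x *\<^sub>R w x)" and K: "compact K"
    and h: "continuous_on UNIV h" "\<And>x. x \<notin> K \<Longrightarrow> h x = 0"
  shows "integrable M (\<lambda>x. w x \<bullet> h x)"
proof -
  define w' where "w' x = indicator K x *\<^sub>R w x" for x
  have w': "integrable M w'"
    using w by (simp add: w'_def[abs_def])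
  have "bounded (h ` K)"
    using K h(1) by (meson compact_continuous_image compact_imp_bounded continuous_on_subset subset_UNIV)
  then obtain B where B: "B > 0" "\<And>x. x \<in> K \<Longrightarrow> norm (h x) \<le> B"
    by (auto simp: bounded_pos)
  have hB: "norm (h x) \<le> B" for x
    using B h(2) by (cases "x \<in> K") auto
  have [measurable]: "h \<in> borel_measurable M"
    using borel_measurable_continuous_onI[OF h(1)] measurable_cong_sets[OF M refl] by blast
  have [measurable]: "w' \<in> borel_measurable M"
    using w' by auto
  have "integrable M (\<lambda>x. w' x \<bullet> h x)"
  proof (rule Bochner_Integration.integrable_bound)
    show "integrable M (\<lambda>x. B *\<^sub>R w' x)"
      using w' by simp
    have "norm (w' x \<bullet> h x) \<le> norm (B *\<^sub>R w' x)" for x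
      using Cauchy_Schwarz_ineq2[of "w' x" "h x"] mult_left_mono[OF hB[of x], of "norm (w' x)"] B(1)
      by (simp add: mult.commute)
    then show "AE x in M. norm (w' x \<bullet> h x) \<le> norm (B *\<^sub>R w' x)"
      by simp
  qed simp
  moreover have "w' x \<bullet> h x = w x \<bullet> h x" for x
    using h(2)[of x] by (cases "x \<in> K") (auto simp: w'_def)
  ultimately show ?thesis by simp
qed

lemma integral_inner_convergence:
  fixes w :: "'a::euclidean_space \<Rightarrow> 'b::euclidean_space"
  assumes M: "sets M = sets borel" and w: "integrable M (\<lambda>x. indicator K x *\<^sub>R w x)" and K: "compact K"
    and \<phi>: "\<And>m. continuous_on UNIV (\<phi> m)" "\<And>m x. x \<notin> K \<Longrightarrow> \<phi> m x = 0"
    and \<psi>: "continuous_on UNIV \<psi>" "\<And>x. x \<notin> K \<Longrightarrow> \<psi> x = 0"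
    and lim: "uniform_limit UNIV (\<lambda>m x. \<phi> m x - \<psi> x) (\<lambda>x. 0) sequentially"
  shows "(\<lambda>m. \<integral>x. w x \<bullet> \<phi> m x \<partial>M) \<longlonglongrightarrow> (\<integral>x. w x \<bullet> \<psi> x \<partial>M)"
proof -
  note int = integrable_inner_compact_support[OF M w K]
  have "(\<integral>x. w x \<bullet> \<phi> m x \<partial>M) - (\<integral>x. w x \<bullet> \<psi> x \<partial>M) =
      (\<integral>x. (indicator K x *\<^sub>R w x) \<bullet> (\<phi> m x - \<psi> x) \<partial>M)" for m
  proof -
    have "(indicator K x *\<^sub>R w x) \<bullet> (\<phi> m x - \<psi> x) = w x \<bullet> \<phi> m x - w x \<bullet> \<psi> x" for x
      using \<phi>(2)[of x m] \<psi>(2)[of x] by (cases "x \<in> K") (auto simp: inner_diff_right)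
    then show ?thesis
      using int[OF \<phi>] int[OF \<psi>] by simp
  qed
  then show ?thesis
    using integral_inner_null[OF w lim] by (subst LIM_zero_iff[symmetric]) (simp only:)
qed


text \<open>On fields supported in a compact \<open>K\<close> the functional is bounded by the
  supremum norm times the integral of |\<tau>| over \<open>K\<close>; no derivatives enter, hence
  order 0.\<close>

lemma kernel_dist_matrix_distribution:
  fixes \<tau> :: "real ^ 'n \<Rightarrow> real ^ 'n ^ 'n"
  assumes M: "sets \<nu> = sets borel"
    and int: "\<And>K. compact K \<Longrightarrow> integrable \<nu> (\<lambda>x. indicator K x *\<^sub>R \<tau> x)"
  shows "matrix_distribution 0 (kernel_dist \<nu> \<tau>)"
proof -
  have test: "(\<Phi> \<in> test_space 0) \<longleftrightarrow> continuous_on UNIV \<Phi> \<and> (\<exists>K. compact K \<and> (\<forall>x. x \<notin> K \<longrightarrow> \<Phi> x = 0))"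
    for \<Phi> :: "real ^ 'n \<Rightarrow> real ^ 'n ^ 'n"
    by (simp add: test_space_iff zero_enat_def)
  have integrable: "integrable \<nu> (\<lambda>x. \<tau> x \<bullet> \<Phi> x)" if "\<Phi> \<in> test_space 0" for \<Phi>
    using that integrable_inner_compact_support[OF M int] unfolding test by metis
  show ?thesis
    unfolding matrix_distribution_def kernel_dist_def hs_inner_eq_inner
  proof (intro conjI ballI allI impI)
    fix \<Phi> \<Psi> :: "real ^ 'n \<Rightarrow> real ^ 'n ^ 'n"
    assume "\<Phi> \<in> test_space 0" "\<Psi> \<in> test_space 0"
    then show "(\<integral>x. \<tau> x \<bullet> (\<Phi> x + \<Psi> x) \<partial>\<nu>) = (\<integral>x. \<tau> x \<bullet> \<Phi> x \<partial>\<nu>) + (\<integral>x. \<tau> x \<bullet> \<Psi> x \<partial>\<nu>)"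
      by (simp add: inner_add_right integrable)
  next
    fix \<phi> :: "nat \<Rightarrow> real ^ 'n \<Rightarrow> real ^ 'n ^ 'n" and \<psi>
    assume A: "(\<forall>m. \<phi> m \<in> test_space 0) \<and> \<psi> \<in> test_space 0 \<and> test_converges 0 \<phi> \<psi>"
    then obtain K where K: "compact K" "\<And>m x. x \<notin> K \<Longrightarrow> \<phi> m x = 0"
        and lim: "null_Ck 0 (\<lambda>m x. \<phi> m x - \<psi> x)"
      using test_converges_iff[of \<phi> 0 \<psi>] by (auto simp: zero_enat_def)
    have "\<psi> x = 0" if "x \<notin> K" for x
      by (rule test_converges_support_limit[of 0 \<phi> \<psi> K]) (use A K that in auto)
    then show "(\<lambda>m. \<integral>x. \<tau> x \<bullet> \<phi> m x \<partial>\<nu>) \<longlonglongrightarrow> (\<integral>x. \<tau> x \<bullet> \<psi> x \<partial>\<nu>)"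
      using A K lim
      by (intro integral_inner_convergence[OF M int[OF K(1)] K(1)]) (auto simp: test)
  qed simp
qed

lemma stein_kernel_gauss_locally_integrable:
  fixes \<tau> :: "real ^ 'n \<Rightarrow> real ^ 'n ^ 'n"
  assumes stein: "stein_kernel_gauss \<nu> \<tau>" and M: "sets \<nu> = sets borel" and K: "compact K"
  shows "integrable \<nu> (\<lambda>x. indicator K x *\<^sub>R \<tau> x)"
proof -
  \<comment> \<open>The ball is open, so the test field is linear in a neighbourhood of each point
    of \<open>K\<close> and its Jacobian there is the constant matrix \<open>B\<close>.\<close>
  obtain R where R: "R > 0" "K \<subseteq> ball 0 R"
    using bounded_subset_ballD[OF compact_imp_bounded[OF K], of 0] by blast
  obtain \<eta> :: "real ^ 'n \<Rightarrow> real" where \<eta>: "\<And>n. Ck n \<eta>" "\<And>x. norm x \<le> R \<Longrightarrow> \<eta> x = 1"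
      "\<And>x. R + 1 \<le> norm x \<Longrightarrow> \<eta> x = 0"
    using smooth_cutoff[OF R(1)] by metis
  have "integrable \<nu> (\<lambda>x. (indicator K x *\<^sub>R \<tau> x) \<bullet> B)" for B
  proof -
    define f where "f x = \<eta> x *\<^sub>R (B *v x)" for x
    have "Ck n f" for n
      unfolding f_def[abs_def]
      by (intro Ck_scaleR \<eta>(1) Ck_linear[OF matrix_vector_mul_bounded_linear] Ck_ident)
    moreover have "f x = 0" if "x \<notin> cball 0 (R + 1)" for x
      using \<eta>(3)[of x] that by (simp add: f_def)
    ultimately have "f \<in> test_space \<infinity>"
      unfolding test_space_iff using compact_cball by blast
    then have "integrable \<nu> (\<lambda>x. \<tau> x \<bullet> jacobian f (at x))"
      using stein unfolding stein_kernel_gauss_def hs_inner_eq_inner by blast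
    then have "integrable \<nu> (\<lambda>x. indicator K x *\<^sub>R (\<tau> x \<bullet> jacobian f (at x)))"
      using K M by (intro integrable_mult_indicator) (auto simp: compact_imp_closed)
    moreover have "jacobian f (at x) = B" if "x \<in> K" for x
    proof (rule jacobian_eq)
      have "((\<lambda>x. B *v x) has_derivative (\<lambda>v. B *v v)) (at x)"
        by (rule bounded_linear_imp_has_derivative[OF matrix_vector_mul_bounded_linear])
      then show "(f has_derivative (\<lambda>v. B *v v)) (at x)"
        by (rule has_derivative_transform_within_open[of _ _ _ _ "ball 0 R"])
          (use R that \<eta>(2) in \<open>auto simp: f_def\<close>)
    qed
    then have "indicator K x *\<^sub>R (\<tau> x \<bullet> jacobian f (at x)) = (indicator K x *\<^sub>R \<tau> x) \<bullet> B" for x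
      by (simp add: indicator_def)
    ultimately show ?thesis by (simp only:)
  qed
  \<comment> \<open>Integrability, and with it measurability, of the matrix function is recovered
    from its finitely many coordinates.\<close>
  then have "integrable \<nu> (\<lambda>x. \<Sum>B\<in>Basis. ((indicator K x *\<^sub>R \<tau> x) \<bullet> B) *\<^sub>R B)"
    by (intro Bochner_Integration.integrable_sum integrable_scaleR_left)
  then show ?thesis
    by (simp only: euclidean_representation)
qed

lemma matrix_distribution_tendsto:
  assumes "matrix_distribution k T" "\<And>m. \<phi> m \<in> test_space k" "\<psi> \<in> test_space k" "test_converges k \<phi> \<psi>"
  shows "(\<lambda>m. T (\<phi> m)) \<longlonglongrightarrow> T \<psi>"
proof -
  have "\<forall>\<phi> \<psi>. (\<forall>m. \<phi> m \<in> test_space k) \<and> \<psi> \<in> test_space k \<and> test_converges k \<phi> \<psi> \<longrightarrow>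
      (\<lambda>m. T (\<phi> m)) \<longlonglongrightarrow> T \<psi>"
    using assms(1) unfolding matrix_distribution_def by (elim conjE)
  from this[THEN spec, THEN spec, of \<phi> \<psi>] show ?thesis
    using assms(2-4) by iprover
qed

text \<open>Each side passes to the limit for its own reason: on the left the position x is bounded
  on the common support and \<nu> is finite, on the right the Jacobians converge in C^k.\<close>

lemma stein_dist_gauss_extend:
  fixes T :: "(real ^ 'n \<Rightarrow> real ^ 'n ^ 'n) \<Rightarrow> real"
  assumes T: "stein_dist_gauss k \<nu> T" and prob: "prob_space \<nu>" and M: "sets \<nu> = sets borel"
    and g: "\<And>n. enat n \<le> k \<Longrightarrow> Ck (Suc n) g" and K: "compact K" and supp: "\<And>x. x \<notin> K \<Longrightarrow> g x = 0"
  shows "(\<integral>x. x \<bullet> g x \<partial>\<nu>) = T (\<lambda>x. jacobian g (at x))"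
proof -
  interpret prob_space \<nu> by fact
  have g1: "Ck (Suc 0) g"
    by (rule g) (simp flip: zero_enat_def)
  note cont = Ck_imp_continuous[OF g1]
  obtain h K' where K': "compact K'" and supp': "\<And>x. x \<notin> K' \<Longrightarrow> g x = 0"
      "\<And>m x. x \<notin> K' \<Longrightarrow> h m x = 0" and Ckh: "\<And>m n. Ck n (h m)"
      and lim: "\<And>n. Ck n g \<Longrightarrow> null_Ck n (\<lambda>m x. h m x - g x)"
    by (rule smooth_approximation[OF cont K supp]) (assumption, rule that)
  have lim_lhs: "(\<lambda>m. \<integral>x. x \<bullet> h m x \<partial>\<nu>) \<longlonglongrightarrow> (\<integral>x. x \<bullet> g x \<partial>\<nu>)"
  proof (rule integral_inner_convergence[OF M _ K' _ supp'(2) cont supp'(1)])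
    have "bounded K'"
      using K' by (rule compact_imp_bounded)
    then obtain B where "\<And>x. x \<in> K' \<Longrightarrow> norm x \<le> B"
      by (auto simp: bounded_iff)
    then have "norm (indicator K' x *\<^sub>R x) \<le> \<bar>B\<bar>" for x
      by (cases "x \<in> K'") (auto intro: order_trans[OF _ abs_ge_self])
    then have bound: "AE x in \<nu>. norm (indicator K' x *\<^sub>R x) \<le> \<bar>B\<bar>"
      by simp
    have "K' \<in> sets \<nu>"
      using K' M by (simp add: compact_imp_closed)
    then have "(\<lambda>x. indicator K' x *\<^sub>R x) \<in> borel_measurable \<nu>"
      by (intro borel_measurable_scaleR borel_measurable_indicator measurable_ident_sets M)
    then show "integrable \<nu> (\<lambda>x. indicator K' x *\<^sub>R x)"
      by (rule integrable_const_bound[OF bound])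
    show "continuous_on UNIV (h m)" for m
      by (rule Ck_imp_continuous[OF Ckh])
    show "uniform_limit UNIV (\<lambda>m x. h m x - g x) (\<lambda>x. 0) sequentially"
      by (rule null_Ck_imp_uniform[OF lim[OF g1]])
  qed
  have eq: "(\<integral>x. x \<bullet> h m x \<partial>\<nu>) = T (\<lambda>x. jacobian (h m) (at x))" for m
  proof -
    have "h m \<in> test_space \<infinity>"
      unfolding test_space_iff using Ckh supp'(2) K' by blast
    then show ?thesis
      using T unfolding stein_dist_gauss_def by blast
  qed
  have "(\<lambda>m. T (\<lambda>x. jacobian (h m) (at x))) \<longlonglongrightarrow> T (\<lambda>x. jacobian g (at x))"
  proof -
    have zero: "jacobian (h m) (at x) = 0" "jacobian g (at x) = 0" if "x \<notin> K'" for m x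
      using jacobian_zero_outside[OF _ compact_imp_closed[OF K'] _ that] Ckh g1 supp' by blast+
    have test: "(\<lambda>x. jacobian (h m) (at x)) \<in> test_space k" "(\<lambda>x. jacobian g (at x)) \<in> test_space k" for m
      unfolding test_space_iff using Ck_jacobian[OF Ckh] Ck_jacobian[OF g] K' zero by blast+
    have "null_Ck n (\<lambda>m x. jacobian (h m) (at x) - jacobian g (at x))" if "enat n \<le> k" for n
      using null_Ck_jacobian[OF lim[OF g[OF that]]] by (simp add: jacobian_diff[OF Ckh g1])
    then have "test_converges k (\<lambda>m x. jacobian (h m) (at x)) (\<lambda>x. jacobian g (at x))"
      unfolding test_converges_iff[OF test] using K' zero by blast
    moreover have "matrix_distribution k T"
      using T by (simp add: stein_dist_gauss_def)
    ultimately show ?thesis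
      by (rule matrix_distribution_tendsto[OF _ test, rotated])
  qed
  then show ?thesis
    using LIMSEQ_unique[OF lim_lhs] unfolding eq by blast
qed

subsection \<open>Transport along the gradient\<close>

text \<open>The adjoint of passing from a kernel \<tau> for the pushforward to \<tau>(grad V) (Hess
  V)^-1; symmetry of the Hessian removes the transpose. Applied to the Jacobian of \<open>f\<close>
  it gives the Jacobian of the carried-over field.\<close>

definition transport ::
  "(real ^ 'n \<Rightarrow> real) \<Rightarrow> (real ^ 'n \<Rightarrow> real ^ 'n ^ 'n) \<Rightarrow> real ^ 'n \<Rightarrow> real ^ 'n ^ 'n" where
  "transport V \<Phi> = push_zero (grad V) (\<lambda>x. \<Phi> x ** matrix_inv (hess V x))"

lemma transport_add: "transport V (\<lambda>x. \<Phi> x + \<Psi> x) = (\<lambda>y. transport V \<Phi> y + transport V \<Psi> y)"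
  by (simp add: transport_def push_zero_def fun_eq_iff
      bounded_bilinear.add_left[OF bounded_bilinear_matrix_mult])

lemma transport_diff: "transport V (\<lambda>x. \<Phi> x - \<Psi> x) = (\<lambda>y. transport V \<Phi> y - transport V \<Psi> y)"
  by (simp add: transport_def push_zero_def fun_eq_iff
      bounded_bilinear.diff_left[OF bounded_bilinear_matrix_mult])

lemma transport_scaleR: "transport V (\<lambda>x. c *\<^sub>R \<Phi> x) = (\<lambda>y. c *\<^sub>R transport V \<Phi> y)"
  by (simp add: transport_def push_zero_def fun_eq_iff
      bounded_bilinear.scaleR_left[OF bounded_bilinear_matrix_mult])

lemma transport_outside:
  assumes "\<And>x. x \<notin> K \<Longrightarrow> \<Phi> x = 0" "y \<notin> grad V ` K"
  shows "transport V \<Phi> y = 0"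
  unfolding transport_def by (rule push_zero_outside[where K = K]) (use assms in auto)

text \<open>Of the \<open>k + 2\<close> orders one goes to the gradient and one to the Hessian; the
  C^k inverse Hessian can then multiply test functions of order k.\<close>

locale pos_def_hessian =
  fixes V :: "real ^ 'n \<Rightarrow> real" and k :: enat
  assumes V: "class_C (k + 2) V" and H: "\<And>x. pos_def (hess V x)"
begin

lemma Ck_grad_V:
  assumes "enat n \<le> k"
  shows "Ck (Suc n) (grad V)"
proof -
  have "enat (Suc (Suc n)) \<le> k + 2"
    using assms by (cases k) (auto simp: numeral_eq_enat)
  then show ?thesis
    using V unfolding class_C_iff_Ck by (blast intro: Ck_grad)
qed

lemma C1_grad_V: "Ck (Suc 0) (grad V)"
  by (rule Ck_grad_V) (simp flip: zero_enat_def)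

lemma grad_V_has_derivative: "(grad V has_derivative (\<lambda>v. hess V x *v v)) (at x)"
  using Ck_Suc_has_derivative_jacobian[OF C1_grad_V] by (simp add: hess_def)

lemma hess_V_invertible: "invertible (hess V x)"
  by (rule pos_def_invertible[OF H])

lemma transpose_inv_hess_V: "transpose (matrix_inv (hess V x)) = matrix_inv (hess V x)"
  using transpose_matrix_inv_symmetric[OF hess_V_invertible] H by (simp add: pos_def_def)

sublocale nonsingular_injection "grad V" "\<lambda>x v. hess V x *v v" "\<lambda>x v. matrix_inv (hess V x) *v v"
  by (intro nonsingular_injection.intro inj_if_pos_def_derivative[OF grad_V_has_derivative H]
      grad_V_has_derivative matrix_vector_mul_bounded_linear)
    (simp add: matrix_vector_mul_assoc matrix_inv_inverse(1)[OF hess_V_invertible])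

lemma Ck_inv_hess_V_mult:
  assumes "enat n \<le> k"
  shows "Ck n (\<lambda>x. matrix_inv (hess V x) *v v)"
proof (rule Ck_matrix_inv_mult[OF _ hess_V_invertible])
  show "Ck n (\<lambda>x. hess V x $ i $ j)" for i j
    using Ck_jacobian[OF Ck_grad_V[OF assms]] unfolding hess_def
    by (intro Ck_linear[OF bounded_linear_vec_nth])
qed

lemma Ck_inv_hess_V: "enat n \<le> k \<Longrightarrow> Ck n (\<lambda>x. matrix_inv (hess V x))"
  by (rule Ck_matrix[OF Ck_inv_hess_V_mult])

lemma Ck_pred_inv_hess_V_mult:
  assumes "enat n \<le> k"
  shows "Ck (n - 1) (\<lambda>x. matrix_inv (hess V x) *v v)"
  using Ck_inv_hess_V_mult[OF assms] Ck_mono diff_le_self by blast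

lemma dist_mult_dist_comp_eq_transport:
  "dist_mult (dist_comp T (grad V)) (\<lambda>x. matrix_inv (hess V x)) = (\<lambda>\<Phi>. T (transport V \<Phi>))"
  unfolding dist_mult_def[abs_def] dist_comp_def transport_def push_zero_def[abs_def]
    transpose_inv_hess_V
  by (rule refl)

lemma transport_test_space:
  assumes "\<Phi> \<in> test_space k"
  shows "transport V \<Phi> \<in> test_space k"
proof -
  obtain K where K: "compact K" "\<And>x. x \<notin> K \<Longrightarrow> \<Phi> x = 0"
    using assms unfolding test_space_iff by blast
  have "Ck n (transport V \<Phi>)" if n: "enat n \<le> k" for n
    unfolding transport_def
  proof (rule Ck_push_zero[OF K(1)])
    show "Ck n (\<lambda>x. \<Phi> x ** matrix_inv (hess V x))"
      using assms n unfolding test_space_iff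
      by (intro Ck_bilinear[OF bounded_bilinear_matrix_mult] Ck_inv_hess_V) auto
    show "Ck (n - 1) (\<lambda>x. matrix_inv (hess V x) *v v)" for v
      by (rule Ck_pred_inv_hess_V_mult[OF n])
  qed (use K in simp)
  moreover have "transport V \<Phi> y = 0" if "y \<notin> grad V ` K" for y
    by (rule transport_outside[of K]) (use K(2) that in auto)
  ultimately show ?thesis
    unfolding test_space_iff using compact_image[OF K(1)] by blast
qed

lemma transport_test_converges:
  assumes test: "\<And>m. \<phi> m \<in> test_space k" "\<psi> \<in> test_space k" and conv: "test_converges k \<phi> \<psi>"
  shows "test_converges k (\<lambda>m. transport V (\<phi> m)) (transport V \<psi>)"
proof -
  from conv obtain K where K: "compact K" "\<And>m x. x \<notin> K \<Longrightarrow> \<phi> m x = 0"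
      and lim: "\<And>n. enat n \<le> k \<Longrightarrow> null_Ck n (\<lambda>m x. \<phi> m x - \<psi> x)"
    unfolding test_converges_iff[OF test] by blast
  have \<psi>_supp: "\<psi> x = 0" if "x \<notin> K" for x
    by (rule test_converges_support_limit[OF conv K(2) that])
  have "null_Ck n (\<lambda>m y. transport V (\<phi> m) y - transport V \<psi> y)" if n: "enat n \<le> k" for n
    unfolding transport_diff[symmetric] unfolding transport_def
  proof (rule null_Ck_push_zero[OF K(1)])
    show "null_Ck n (\<lambda>m x. (\<phi> m x - \<psi> x) ** matrix_inv (hess V x))"
      by (rule null_Ck_bilinear[OF bounded_bilinear.flip[OF bounded_bilinear_matrix_mult] K(1)
            Ck_inv_hess_V[OF n] lim[OF n]]) (simp add: K(2) \<psi>_supp)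
    show "Ck (n - 1) (\<lambda>x. matrix_inv (hess V x) *v v)" for v
      by (rule Ck_pred_inv_hess_V_mult[OF n])
  qed (use K(2) \<psi>_supp in simp)
  moreover have "transport V (\<phi> m) y = 0" if "y \<notin> grad V ` K" for m y
    by (rule transport_outside[of K]) (use K(2) that in auto)
  ultimately show ?thesis
    unfolding test_converges_iff[OF transport_test_space transport_test_space, OF test]
    using compact_image[OF K(1)] by blast
qed

lemma matrix_distribution_transport:
  assumes T: "matrix_distribution k T"
  shows "matrix_distribution k (\<lambda>\<Phi>. T (transport V \<Phi>))"
  unfolding matrix_distribution_def
proof (intro conjI ballI allI impI)
  fix \<Phi> \<Psi> :: "real ^ 'n \<Rightarrow> real ^ 'n ^ 'n"
  assume "\<Phi> \<in> test_space k" "\<Psi> \<in> test_space k"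
  then show "T (transport V (\<lambda>x. \<Phi> x + \<Psi> x)) = T (transport V \<Phi>) + T (transport V \<Psi>)"
    unfolding transport_add using T transport_test_space unfolding matrix_distribution_def by blast
next
  fix c and \<Phi> :: "real ^ 'n \<Rightarrow> real ^ 'n ^ 'n" assume "\<Phi> \<in> test_space k"
  then show "T (transport V (\<lambda>x. c *\<^sub>R \<Phi> x)) = c * T (transport V \<Phi>)"
    unfolding transport_scaleR using T transport_test_space unfolding matrix_distribution_def by blast
next
  fix \<phi> :: "nat \<Rightarrow> real ^ 'n \<Rightarrow> real ^ 'n ^ 'n" and \<psi>
  assume "(\<forall>m. \<phi> m \<in> test_space k) \<and> \<psi> \<in> test_space k \<and> test_converges k \<phi> \<psi>"
  then show "(\<lambda>m. T (transport V (\<phi> m))) \<longlonglongrightarrow> T (transport V \<psi>)"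
    using transport_test_space transport_test_converges
    by (intro matrix_distribution_tendsto[OF T]) auto
qed

text \<open>The chain rule in matrix form. It holds at every \<open>y\<close>, since off the range
  both sides are 0.\<close>

lemma jacobian_push_zero_grad:
  fixes f :: "real ^ 'n \<Rightarrow> real ^ 'n"
  assumes K: "compact K" "\<And>x. x \<notin> K \<Longrightarrow> f x = 0" and f: "Ck (Suc 0) f"
  shows "jacobian (push_zero (grad V) f) (at y) = transport V (\<lambda>x. jacobian f (at x)) y"
proof (rule jacobian_eq)
  have "(push_zero (grad V) f has_derivative
      (\<lambda>v. push_zero (grad V) (\<lambda>x. jacobian f (at x) *v (matrix_inv (hess V x) *v v)) y)) (at y)"
    by (rule push_zero_has_derivative[OF K Ck_Suc_has_derivative_jacobian[OF f]])
  then show "(push_zero (grad V) f has_derivative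
      (\<lambda>v. transport V (\<lambda>x. jacobian f (at x)) y *v v)) (at y)"
    by (simp add: transport_def push_zero_def matrix_vector_mul_assoc
        if_distrib[of "\<lambda>B. B *v _"] cong: if_cong)
qed

lemma stein_dist_transfer:
  assumes prob: "prob_space \<mu>" and M: "sets \<mu> = sets borel"
    and T: "stein_dist_gauss k (distr \<mu> borel (grad V)) T"
  shows "stein_dist_rel k V \<mu> (dist_mult (dist_comp T (grad V)) (\<lambda>x. matrix_inv (hess V x)))"
proof -
  have "(\<integral>x. grad V x \<bullet> f x \<partial>\<mu>) = T (transport V (\<lambda>x. jacobian f (at x)))"
    if f: "f \<in> test_space \<infinity>" for f
  proof -
    obtain K where K: "compact K" "\<And>x. x \<notin> K \<Longrightarrow> f x = 0"
      using f unfolding test_space_iff by blast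
    have Ck_f: "Ck n f" for n
      using f by (simp add: test_space_iff)
    \<comment> \<open>Order \<open>Suc n\<close> needs the inverse derivative only to order n, one
      less than the field; this is the order by which \<open>g\<close> exceeds the inverse
      Hessian.\<close>
    have Ck_g: "Ck (Suc n) (push_zero (grad V) f)" if "enat n \<le> k" for n
      by (rule Ck_push_zero[OF K(1) Ck_f K(2)]) (use Ck_inv_hess_V_mult[OF that] in auto)
    have meas: "grad V \<in> borel_measurable \<mu>"
      using borel_measurable_continuous_onI[OF cont] measurable_cong_sets[OF M refl] by blast
    have "(\<integral>y. y \<bullet> push_zero (grad V) f y \<partial>distr \<mu> borel (grad V)) =
        T (\<lambda>y. jacobian (push_zero (grad V) f) (at y))"
    proof (rule stein_dist_gauss_extend[OF T _ _ Ck_g compact_image[OF K(1)]])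
      show "prob_space (distr \<mu> borel (grad V))"
        by (rule prob_space.prob_space_distr[OF prob meas])
      show "push_zero (grad V) f y = 0" if "y \<notin> grad V ` K" for y
        by (rule push_zero_outside[where K = K]) (use K(2) that in auto)
    qed simp
    moreover have "(\<integral>y. y \<bullet> push_zero (grad V) f y \<partial>distr \<mu> borel (grad V)) =
        (\<integral>x. grad V x \<bullet> f x \<partial>\<mu>)"
    proof (subst integral_distr[OF meas])
      have "continuous_on UNIV (push_zero (grad V) f)"
        by (rule Ck_imp_continuous[OF Ck_g[of 0]]) (simp flip: zero_enat_def)
      then show "(\<lambda>y. y \<bullet> push_zero (grad V) f y) \<in> borel_measurable borel"
        by (intro borel_measurable_continuous_onI continuous_intros)
    qed (simp add: push_zero_apply[OF inj])
    ultimately show ?thesis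
      by (simp add: jacobian_push_zero_grad[OF K Ck_f])
  qed
  then show ?thesis
    using T matrix_distribution_transport
    unfolding dist_mult_dist_comp_eq_transport stein_dist_rel_def stein_dist_gauss_def by blast
qed

end

section \<open>Kernels that are functions\<close>

text \<open>The distributional result at order 0 yields the identity. The integrability demanded by
  \<open>stein_kernel_rel\<close> is obtained separately, from the transported field being
  continuous with compact support and \<tau> being locally integrable.\<close>

lemma stein_kernel_transfer:
  fixes V :: "real ^ 'n \<Rightarrow> real"
  assumes V: "class_C 2 V" and H: "\<And>x. pos_def (hess V x)"
    and prob: "prob_space \<mu>" and M: "sets \<mu> = sets borel"
    and \<tau>: "stein_kernel_gauss (distr \<mu> borel (grad V)) \<tau>"
  shows "stein_kernel_rel V \<mu> (\<lambda>x. \<tau> (grad V x) ** matrix_inv (hess V x))"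
proof -
  interpret pos_def_hessian V 0
    by unfold_locales (use V H in simp_all)
  let ?\<nu> = "distr \<mu> borel (grad V)"
  have sets: "sets ?\<nu> = sets borel" by simp
  note int = stein_kernel_gauss_locally_integrable[OF \<tau> sets]
  have "stein_dist_gauss 0 ?\<nu> (kernel_dist ?\<nu> \<tau>)"
    using kernel_dist_matrix_distribution[OF sets int] \<tau>
    unfolding stein_dist_gauss_def stein_kernel_gauss_def kernel_dist_def by blast
  from stein_dist_transfer[OF prob M this]
  have stein: "(\<integral>x. grad V x \<bullet> f x \<partial>\<mu>) = kernel_dist ?\<nu> \<tau> (transport V (\<lambda>x. jacobian f (at x)))"
    if "f \<in> test_space \<infinity>" for f
    using that unfolding stein_dist_rel_def dist_mult_dist_comp_eq_transport by blast
  have meas: "grad V \<in> borel_measurable \<mu>"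
    using borel_measurable_continuous_onI[OF cont] measurable_cong_sets[OF M refl] by blast
  show ?thesis
    unfolding stein_kernel_rel_def
  proof (intro allI impI)
    fix f :: "real ^ 'n \<Rightarrow> real ^ 'n" assume f: "f \<in> test_space \<infinity>"
    define \<Phi> where "\<Phi> = transport V (\<lambda>x. jacobian f (at x))"
    obtain K where K: "compact K" "\<And>x. x \<notin> K \<Longrightarrow> f x = 0"
      using f unfolding test_space_iff by blast
    have Ck_f: "Ck n f" for n
      using f by (simp add: test_space_iff)
    have "(\<lambda>x. jacobian f (at x)) \<in> test_space 0"
      unfolding test_space_iff
      using Ck_jacobian[OF Ck_f] jacobian_zero_outside[OF Ck_f compact_imp_closed[OF K(1)] K(2)] K(1)
      by blast
    then have "\<Phi> \<in> test_space 0"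
      unfolding \<Phi>_def by (rule transport_test_space)
    then obtain L where L: "compact L" "\<And>y. y \<notin> L \<Longrightarrow> \<Phi> y = 0" "continuous_on UNIV \<Phi>"
      unfolding test_space_iff using Ck_imp_continuous i0_lb zero_enat_def by metis
    have int\<Phi>: "integrable ?\<nu> (\<lambda>y. hs_inner (\<tau> y) (\<Phi> y))"
      unfolding hs_inner_eq_inner
      by (rule integrable_inner_compact_support[OF sets int[OF L(1)] L(1,3,2)])
    \<comment> \<open>The change of variables needs measurability of the pairing; it is read off
      from integrability, as \<tau> comes with no measurability of its own.\<close>
    then have meas\<Phi>: "(\<lambda>y. hs_inner (\<tau> y) (\<Phi> y)) \<in> borel_measurable borel"
      using borel_measurable_integrable by force
    have \<Phi>_grad: "hs_inner (\<tau> (grad V x)) (\<Phi> (grad V x)) =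
        hs_inner (\<tau> (grad V x) ** matrix_inv (hess V x)) (jacobian f (at x))" for x
      by (simp add: \<Phi>_def transport_def push_zero_apply[OF inj] transpose_inv_hess_V
          flip: hs_inner_mult_transpose)
    show "integrable \<mu> (\<lambda>x. hs_inner (\<tau> (grad V x) ** matrix_inv (hess V x)) (jacobian f (at x))) \<and>
        (\<integral>x. grad V x \<bullet> f x \<partial>\<mu>) =
        (\<integral>x. hs_inner (\<tau> (grad V x) ** matrix_inv (hess V x)) (jacobian f (at x)) \<partial>\<mu>)"
      using int\<Phi> stein[OF f]
      unfolding kernel_dist_def integrable_distr_eq[OF meas meas\<Phi>] \<Phi>_def[symmetric]
        integral_distr[OF meas meas\<Phi>] \<Phi>_grad
      by blast
  qed
qed

theorem mainTheorem7:
  fixes V :: "real ^ 'n \<Rightarrow> real" and \<mu> :: "(real ^ 'n) measure"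
  assumes "convex_on UNIV V"
    and "class_C 2 V"
    and "\<And>x. pos_def (hess V x)"
    and "prob_space (density lborel (\<lambda>x. ennreal (exp (- V x))))"
    and "prob_space \<mu>" and "sets \<mu> = sets borel"
  shows "(\<forall>\<tau>. stein_kernel_gauss (distr \<mu> borel (grad V)) \<tau> \<longrightarrow>
            stein_kernel_rel V \<mu> (\<lambda>x. \<tau> (grad V x) ** matrix_inv (hess V x))) \<and>
         (\<forall>k T. class_C (k + 2) V \<and> stein_dist_gauss k (distr \<mu> borel (grad V)) T \<longrightarrow>
            stein_dist_rel k V \<mu> (dist_mult (dist_comp T (grad V)) (\<lambda>x. matrix_inv (hess V x))))"
proof (intro conjI allI impI)
  fix \<tau> assume "stein_kernel_gauss (distr \<mu> borel (grad V)) \<tau>"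
  then show "stein_kernel_rel V \<mu> (\<lambda>x. \<tau> (grad V x) ** matrix_inv (hess V x))"
    by (rule stein_kernel_transfer[OF assms(2,3,5,6)])
next
  fix k T assume *: "class_C (k + 2) V \<and> stein_dist_gauss k (distr \<mu> borel (grad V)) T"
  interpret pos_def_hessian V k
    by unfold_locales (use * assms(3) in simp_all)
  show "stein_dist_rel k V \<mu> (dist_mult (dist_comp T (grad V)) (\<lambda>x. matrix_inv (hess V x)))"
    using stein_dist_transfer[OF assms(5,6)] * by blast
qed

end
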